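(* For any finite abelian $p$-groups $F_1,F_2$, $$c_0\sum_{G}\frac{\#\mathrm{Sur}(G,F_1)\,\#\mathrm{Sur}(G,F_2)}{\#\mathrm{Aut}(G)}=\sum_{G'}\frac{\#\mathrm{Sur}(F_1,G')\,\#\mathrm{Sur}(F_2,G')}{\#\mathrm{Aut}(G')},$$ where both sums run over isomorphism classes of finite abelian $p$-groups.
   Context: Fix a prime $p$. $c_0=\prod_{i\ge1}(1-p^{-i})$. $\mathrm{Sur}(A,B)$ is the set of surjective group homomorphisms $A\to B$. *)

theory Defs
  imports "HOL-Analysis.Analysis" "HOL-Algebra.Algebra" "HOL-Computational_Algebra.Primes"
begin

definition finite_abelian_p_group :: "nat \<Rightarrow> ('a, 'b) monoid_scheme \<Rightarrow> bool" where
  "finite_abelian_p_group p G \<longleftrightarrow>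
     comm_group G \<and> finite (carrier G) \<and> (\<exists>n. order G = p ^ n)"

text \<open>Maps are total functions here, so surjective homomorphisms must be made
  extensional (undefined off the carrier) in order to be counted correctly. The
  library set \<open>auto G\<close> of automorphisms is extensional already.\<close>

definition Sur :: "('a, 'c) monoid_scheme \<Rightarrow> ('b, 'd) monoid_scheme \<Rightarrow> ('a \<Rightarrow> 'b) set" where
  "Sur G H = epi G H \<inter> extensional (carrier G)"

text \<open>Every finite group has an isomorphic copy with carrier a set of natural numbers,
  so the isomorphism classes of finite abelian \<open>p\<close>-groups are those of the groups
  with elements in \<open>nat\<close>. A sum over isomorphism classes is a sum over one chosen
  representative of each class (see \<open>ex1_iso_reps\<close> below).\<close>

definition nat_p_groups :: "nat \<Rightarrow> nat monoid set" where
  "nat_p_groups p = {G. finite_abelian_p_group p G}"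

definition iso_rel :: "nat \<Rightarrow> (nat monoid \<times> nat monoid) set" where
  "iso_rel p = {(G, H). G \<in> nat_p_groups p \<and> H \<in> nat_p_groups p \<and> G \<cong> H}"

definition iso_reps :: "nat \<Rightarrow> nat monoid set" where
  "iso_reps p = (\<lambda>C. SOME G. G \<in> C) ` (nat_p_groups p // iso_rel p)"

definition c0 :: "nat \<Rightarrow> real" where
  "c0 p = prodinf (\<lambda>i. 1 - 1 / real p ^ Suc i)"

lemma equiv_iso_rel: "equiv (nat_p_groups p) (iso_rel p)"
proof (rule equivI)
  show "iso_rel p \<subseteq> nat_p_groups p \<times> nat_p_groups p"
    by (auto simp: iso_rel_def)
  show "refl_on (nat_p_groups p) (iso_rel p)"
    by (auto simp: refl_on_def iso_rel_def)
  show "sym (iso_rel p)"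
    by (auto simp: sym_def iso_rel_def nat_p_groups_def finite_abelian_p_group_def
        comm_group_def intro: group.iso_sym)
  show "trans (iso_rel p)"
    by (auto simp: trans_def iso_rel_def intro: iso_trans)
qed

lemma ex_nat_copy:
  assumes "finite_abelian_p_group p G"
  shows "\<exists>H \<in> nat_p_groups p. G \<cong> H"
proof -
  have G: "comm_group G" "group G" and fin: "finite (carrier G)"
    and ord: "\<exists>n. order G = p ^ n"
    using assms by (auto simp: finite_abelian_p_group_def comm_group_def)
  obtain f :: "'a \<Rightarrow> nat" where inj: "inj_on f (carrier G)"
    using finite_imp_inj_to_nat_seg[OF fin] by blast
  define H where "H = image_group f G"
  have iso: "f \<in> iso G H"
    unfolding H_def iso_def hom_def bij_betw_def image_group_def
    using inj G(2) by (auto simp: inj_on_def group.is_monoid monoid.m_closed inv_into_f_f[OF inj])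
  hence GH: "G \<cong> H" by (rule is_isoI)
  have "comm_group (H\<lparr>one := f \<one>\<^bsub>G\<^esub>\<rparr>)"
    using comm_group.iso_imp_img_comm_group[OF G(1) iso] .
  hence "comm_group H" by (simp add: H_def image_group_def)
  moreover have "finite (carrier H)" using iso_finite[OF GH] fin by simp
  moreover have "order H = order G" using iso_same_card[OF GH] by (simp add: order_def)
  ultimately have "H \<in> nat_p_groups p"
    using ord by (simp add: nat_p_groups_def finite_abelian_p_group_def)
  with GH show ?thesis by blast
qed

lemma iso_reps_subset: "iso_reps p \<subseteq> nat_p_groups p"
proof
  fix H assume "H \<in> iso_reps p"
  then obtain C where C: "C \<in> nat_p_groups p // iso_rel p" "H = (SOME G. G \<in> C)"
    by (auto simp: iso_reps_def)
  from C(1) have "C \<noteq> {}" by (rule in_quotient_imp_non_empty[OF equiv_iso_rel])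
  hence "H \<in> C" using C(2) by (simp add: some_in_eq)
  thus "H \<in> nat_p_groups p"
    using in_quotient_imp_subset[OF equiv_iso_rel C(1)] by blast
qed

lemma ex1_iso_reps:
  assumes "finite_abelian_p_group p G"
  shows "\<exists>!H. H \<in> iso_reps p \<and> G \<cong> H"
proof -
  have gG: "group G" using assms by (auto simp: finite_abelian_p_group_def comm_group_def)
  have mem: "(SOME G. G \<in> C) \<in> C" if "C \<in> nat_p_groups p // iso_rel p" for C
    using in_quotient_imp_non_empty[OF equiv_iso_rel that] by (simp add: some_in_eq)
  obtain K where K: "K \<in> nat_p_groups p" "G \<cong> K" using ex_nat_copy[OF assms] by blast
  define C where "C = iso_rel p `` {K}"
  have C: "C \<in> nat_p_groups p // iso_rel p" unfolding C_def using K(1) by (rule quotientI)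
  define H where "H = (SOME G. G \<in> C)"
  have "H \<in> C" using mem[OF C] by (simp add: H_def)
  hence KH: "K \<cong> H" by (auto simp: C_def iso_rel_def)
  show ?thesis
  proof (rule ex1I[of _ H])
    show "H \<in> iso_reps p \<and> G \<cong> H"
      using C K(2) KH by (auto simp: iso_reps_def H_def intro: iso_trans)
  next
    fix H' assume H': "H' \<in> iso_reps p \<and> G \<cong> H'"
    then obtain Y where Y: "Y \<in> nat_p_groups p // iso_rel p" "H' = (SOME G. G \<in> Y)"
      by (auto simp: iso_reps_def)
    have H'Y: "H' \<in> Y" using mem[OF Y(1)] Y(2) by simp
    have H'p: "H' \<in> nat_p_groups p" using H' iso_reps_subset by blast
    have "K \<cong> H'"
      using iso_trans[OF _ conjunct2[OF H']] group.iso_sym[OF gG K(2)] by blast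
    hence "(K, H') \<in> iso_rel p" using K(1) H'p by (simp add: iso_rel_def)
    hence "H' \<in> C" by (simp add: C_def)
    hence "C = Y"
      using quotient_disj[OF equiv_iso_rel C Y(1)] H'Y by blast
    thus "H' = H" using Y(2) H_def by simp
  qed
qed

end

theory Submission
  imports Defs
begin

text \<open>Both sides count the subdirect products of \<open>F1\<close> and \<open>F2\<close>, that is the subgroups \<open>H\<close> of
\<open>F1 \<times> F2\<close> that project onto both factors; the factor \<open>c0\<close> on the left enters through the fact that,
with \<open>G\<close> weighted by \<open>c0 / #Aut G\<close>, the number of surjections \<open>G \<rightarrow> F\<close> has mean exactly 1
for every \<open>F\<close>.

Right side. By Goursat's lemma a subdirect product is the fibre product of two surjections
\<open>F1 \<rightarrow> G'\<close> and \<open>F2 \<rightarrow> G'\<close>; its group \<open>G'\<close> is determined up to isomorphism, and the pair of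
surjections up to an automorphism of \<open>G'\<close>. Hence the right side is the number of subdirect
products (\<open>has_sum_card_subdirect\<close>).

Left side. A pair of surjections from \<open>G\<close> to \<open>F1\<close> and \<open>F2\<close> is one homomorphism to \<open>F1 \<times> F2\<close>
whose image is subdirect, so the numerator is the sum of \<open>#Sur(G, H)\<close> over subdirect \<open>H\<close>
(\<open>card_Sur_pairs\<close>). It remains to see that the sum of \<open>#Sur(G, F) / #Aut(G)\<close> over all \<open>G\<close> is
\<open>1 / c0\<close> for each \<open>F\<close> (\<open>has_sum_Sur_moment\<close>).

For that last fact, present the groups \<open>G\<close> as quotients of \<open>\<int>\<^sup>m\<close>. Two surjections
\<open>\<int>\<^sup>m \<rightarrow> G\<close> have the same kernel exactly if they differ by an automorphism of \<open>G\<close>, so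
\<open>#Sur(\<int>\<^sup>m, G) / #Aut(G)\<close> counts the sublattices with quotient \<open>G\<close>. Counting pairs of a
surjection \<open>f : \<int>\<^sup>m \<rightarrow> F\<close> and a sublattice \<open>L\<close> of \<open>ker f\<close> in two ways relates the groups \<open>G\<close>
of order \<open>p\<^sup>n \<cdot> #F\<close> to the sublattices of index \<open>p\<^sup>n\<close> in \<open>ker f\<close>. The number of the latter
depends only on \<open>m\<close> and \<open>n\<close>, since \<open>ker f\<close> is again a lattice of rank \<open>m\<close>
(\<open>card_index_subgroups\<close>). After normalisation by \<open>#G\<^sup>m\<close>, the limit \<open>m \<rightarrow> \<infinity>\<close> removes the
auxiliary surjections, because a random \<open>m\<close>-tuple generates a fixed finite group with probability
tending to 1 (\<open>Sur_Zn_density\<close>). What is left is the limit of the sublattice counts, whose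
generating series is, for each \<open>m\<close>, a finite product of geometric series with sum
\<open>1 / \<Prod>i\<le>m. (1 - p\<^sup>-\<^sup>i)\<close> (\<open>sublattice_series_sums\<close>), and these sums increase to \<open>1 / c0\<close>.\<close>

section \<open>Transversals and indices of subgroups of an additive group\<close>

text \<open>A set-based notion on a type of additive groups: the lattices below live in the type of
finitely supported integer functions, and staying with its \<open>+\<close> and \<open>-\<close> keeps the arithmetic of
cosets within reach of the simplifier. The link to group structures is \<open>subgroup_Zn_iff\<close>.\<close>

definition add_subgroup :: "'a::ab_group_add set \<Rightarrow> bool" where
  "add_subgroup L \<longleftrightarrow> 0 \<in> L \<and> (\<forall>x\<in>L. \<forall>y\<in>L. x - y \<in> L)"

definition cosets :: "'a::ab_group_add set \<Rightarrow> 'a set \<Rightarrow> 'a set set" where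
  "cosets M L = (\<lambda>x. (+) x ` L) ` M"

abbreviation index :: "'a::ab_group_add set \<Rightarrow> 'a set \<Rightarrow> nat" where
  "index M L \<equiv> card (cosets M L)"

text \<open>Indices are computed by exhibiting transversals, which turns index formulas into
bijections between sets of representatives.\<close>

definition transversal :: "'a::ab_group_add set \<Rightarrow> 'a set \<Rightarrow> 'a set \<Rightarrow> bool" where
  "transversal T M L \<longleftrightarrow> T \<subseteq> M \<and> (\<forall>x\<in>M. \<exists>!t. t \<in> T \<and> x - t \<in> L)"

lemma add_subgroup_zero: "add_subgroup L \<Longrightarrow> 0 \<in> L"
  and add_subgroup_diff: "add_subgroup L \<Longrightarrow> x \<in> L \<Longrightarrow> y \<in> L \<Longrightarrow> x - y \<in> L"
  by (auto simp: add_subgroup_def)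

lemma add_subgroup_minus: "add_subgroup L \<Longrightarrow> x \<in> L \<Longrightarrow> - x \<in> L"
  using add_subgroup_diff[of L 0 x] add_subgroup_zero by force

lemma add_subgroup_add: "add_subgroup L \<Longrightarrow> x \<in> L \<Longrightarrow> y \<in> L \<Longrightarrow> x + y \<in> L"
  using add_subgroup_diff[of L x "- y"] add_subgroup_minus by force

lemma add_subgroup_diff_commute: "add_subgroup L \<Longrightarrow> x - y \<in> L \<Longrightarrow> y - x \<in> L"
  using add_subgroup_minus[of L "x - y"] by simp

lemma coset_eq_iff:
  assumes "add_subgroup L"
  shows "(+) x ` L = (+) y ` L \<longleftrightarrow> x - y \<in> L"
proof
  assume "(+) x ` L = (+) y ` L"
  then have "x + 0 \<in> (+) y ` L" using add_subgroup_zero[OF assms] by blast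
  then show "x - y \<in> L" by auto
next
  assume d: "x - y \<in> L"
  have "(+) x ` L \<subseteq> (+) y ` L" if "x - y \<in> L" for x y
  proof
    fix z assume "z \<in> (+) x ` L"
    then obtain l where l: "l \<in> L" "z = y + ((x - y) + l)" by auto
    then show "z \<in> (+) y ` L" using add_subgroup_add[OF assms that l(1)] by blast
  qed
  from this[OF d] this[OF add_subgroup_diff_commute[OF assms d]]
  show "(+) x ` L = (+) y ` L" by blast
qed

lemma bij_betw_transversal_cosets:
  assumes "add_subgroup L" "transversal T M L"
  shows "bij_betw (\<lambda>x. (+) x ` L) T (cosets M L)"
  unfolding bij_betw_def
proof
  show "inj_on (\<lambda>x. (+) x ` L) T"
  proof (rule inj_onI)
    fix s t assume st: "s \<in> T" "t \<in> T" "(+) s ` L = (+) t ` L"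
    then have "s \<in> M" "s - t \<in> L" "s - s \<in> L"
      using assms coset_eq_iff[OF assms(1), of s t] by (auto simp: transversal_def add_subgroup_zero)
    then show "s = t" using assms(2) st unfolding transversal_def by blast
  qed
  show "(\<lambda>x. (+) x ` L) ` T = cosets M L"
  proof
    show "cosets M L \<subseteq> (\<lambda>x. (+) x ` L) ` T"
    proof
      fix c assume "c \<in> cosets M L"
      then obtain x where x: "x \<in> M" "c = (+) x ` L" by (auto simp: cosets_def)
      then obtain t where "t \<in> T" "x - t \<in> L" using assms(2) by (auto simp: transversal_def)
      then show "c \<in> (\<lambda>x. (+) x ` L) ` T" using x coset_eq_iff[OF assms(1), of x t] by auto
    qed
  qed (use assms in \<open>auto simp: cosets_def transversal_def\<close>)
qed

lemma index_transversal:
  assumes "add_subgroup L" "transversal T M L"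
  shows "index M L = card T" "finite (cosets M L) \<longleftrightarrow> finite T"
  using bij_betw_transversal_cosets[OF assms] bij_betw_same_card bij_betw_finite by metis+

lemma ex_transversal:
  assumes "add_subgroup L"
  obtains T where "transversal T M L"
proof
  define rep where "rep c = (SOME t. t \<in> M \<and> (+) t ` L = c)" for c
  have rep: "rep c \<in> M \<and> (+) (rep c) ` L = c" if "c \<in> cosets M L" for c
    unfolding rep_def by (rule someI_ex) (use that in \<open>auto simp: cosets_def\<close>)
  show "transversal (rep ` cosets M L) M L"
    unfolding transversal_def
  proof (intro conjI ballI)
    show "rep ` cosets M L \<subseteq> M" using rep by auto
    fix x assume "x \<in> M"
    then have c: "(+) x ` L \<in> cosets M L" by (auto simp: cosets_def)
    show "\<exists>!t. t \<in> rep ` cosets M L \<and> x - t \<in> L"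
    proof (rule ex1I)
      show "rep ((+) x ` L) \<in> rep ` cosets M L \<and> x - rep ((+) x ` L) \<in> L"
        using c rep[OF c] coset_eq_iff[OF assms] by (metis image_eqI)
      fix t assume "t \<in> rep ` cosets M L \<and> x - t \<in> L"
      then obtain c where c: "c \<in> cosets M L" "t = rep c" "(+) x ` L = (+) t ` L"
        using coset_eq_iff[OF assms, of x t] by blast
      then show "t = rep ((+) x ` L)" using rep[OF c(1)] by simp
    qed
  qed
qed

text \<open>Adding representatives of \<open>A / M\<close> and of \<open>M / L\<close> gives representatives of \<open>A / L\<close>. The
finiteness claim is separate because an infinite set of cosets has cardinality 0.\<close>

lemma index_mult:
  assumes "add_subgroup L" "add_subgroup M" "L \<subseteq> M" "M \<subseteq> A" "add_subgroup A"
  shows "index A L = index A M * index M L"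
    and "finite (cosets A L) \<longleftrightarrow> finite (cosets A M) \<and> finite (cosets M L)"
proof -
  obtain S T where S: "transversal S A M" and T: "transversal T M L"
    using ex_transversal assms by metis
  have SA: "S \<subseteq> A" and TM: "T \<subseteq> M" using S T by (auto simp: transversal_def)
  have eqS: "s = s'" if "s \<in> S" "s' \<in> S" "s - s' \<in> M" for s s'
    using S that assms(2) SA unfolding transversal_def
    by (metis diff_self subsetD add_subgroup_zero)
  have eqT: "t = t'" if "t \<in> T" "t' \<in> T" "t - t' \<in> L" for t t'
    using T that assms(1) TM unfolding transversal_def
    by (metis diff_self subsetD add_subgroup_zero)
  have key: "s = s' \<and> t = t'"
    if *: "s \<in> S" "s' \<in> S" "t \<in> T" "t' \<in> T" "(s + t) - (s' + t') \<in> L" for s s' t t'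
  proof -
    have "(s + t) - (s' + t') + (t' - t) \<in> M"
      using * TM assms(2,3) by (meson subsetD add_subgroup_add add_subgroup_diff)
    then have "s = s'" using * by (intro eqS) (auto simp: algebra_simps)
    with * eqT show ?thesis by auto
  qed
  have inj: "inj_on (\<lambda>(s, t). s + t) (S \<times> T)"
    using key assms(1) by (auto simp: inj_on_def add_subgroup_zero)
  have tr: "transversal ((\<lambda>(s, t). s + t) ` (S \<times> T)) A L"
    unfolding transversal_def
  proof (intro conjI ballI)
    show "(\<lambda>(s, t). s + t) ` (S \<times> T) \<subseteq> A"
      using SA TM assms(4,5) by (auto intro: add_subgroup_add)
    fix x assume "x \<in> A"
    then obtain s where s: "s \<in> S" "x - s \<in> M" using S by (auto simp: transversal_def)
    then obtain t where t: "t \<in> T" "x - s - t \<in> L" using T by (auto simp: transversal_def)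
    show "\<exists>!u. u \<in> (\<lambda>(s, t). s + t) ` (S \<times> T) \<and> x - u \<in> L"
    proof (rule ex1I)
      show "s + t \<in> (\<lambda>(s, t). s + t) ` (S \<times> T) \<and> x - (s + t) \<in> L"
        using s t by (auto simp: algebra_simps)
      fix u assume "u \<in> (\<lambda>(s, t). s + t) ` (S \<times> T) \<and> x - u \<in> L"
      then obtain s' t' where u: "s' \<in> S" "t' \<in> T" "u = s' + t'" "x - u \<in> L" by auto
      have "(x - u) - (x - s - t) \<in> L" using u t assms(1) by (meson add_subgroup_diff)
      then have "(s + t) - (s' + t') \<in> L" by (simp add: u algebra_simps)
      then show "u = s + t" using key[of s s' t t'] s t u by auto
    qed
  qed
  show "index A L = index A M * index M L"
    using index_transversal(1)[OF assms(1) tr] index_transversal(1)[OF assms(2) S]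
      index_transversal(1)[OF assms(1) T] inj by (simp add: card_image card_cartesian_product)
  have "finite (S \<times> T) \<longleftrightarrow> finite S \<and> finite T"
  proof -
    have "S \<noteq> {}" "T \<noteq> {}" using S T assms by (auto simp: transversal_def dest: add_subgroup_zero)
    then show ?thesis by (auto simp: finite_cartesian_product_iff)
  qed
  then show "finite (cosets A L) \<longleftrightarrow> finite (cosets A M) \<and> finite (cosets M L)"
    using index_transversal(2)[OF assms(1) tr] index_transversal(2)[OF assms(2) S]
      index_transversal(2)[OF assms(1) T] finite_image_iff[OF inj] by simp
qed

lemma finite_index_self: "add_subgroup M \<Longrightarrow> index M M = 1 \<and> finite (cosets M M)"
proof -
  assume M: "add_subgroup M"
  then have "transversal {0} M M" by (auto simp: transversal_def add_subgroup_zero)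
  from index_transversal[OF M this] show ?thesis by simp
qed

section \<open>Counting the sublattices of a given index\<close>

abbreviation coord :: "'i \<Rightarrow> ('i \<Rightarrow>\<^sub>0 int) \<Rightarrow> int" where
  "coord i v \<equiv> Poly_Mapping.lookup v i"

lemma coord_simps:
  "coord i (v + w) = coord i v + coord i w"
  "coord i (v - w) = coord i v - coord i w"
  "coord i (- v) = - coord i v"
  "coord i 0 = 0"
  by (simp_all add: lookup_add lookup_minus)

text \<open>The kernel of one coordinate on \<open>L\<close>. Together with a vector whose \<open>i\<close>-th coordinate
generates the image of that coordinate, it determines \<open>L\<close>.\<close>

definition slice :: "'i \<Rightarrow> ('i \<Rightarrow>\<^sub>0 int) set \<Rightarrow> ('i \<Rightarrow>\<^sub>0 int) set" where
  "slice i L = {v \<in> L. coord i v = 0}"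

definition coord_generator :: "'i \<Rightarrow> ('i \<Rightarrow>\<^sub>0 int) \<Rightarrow> ('i \<Rightarrow>\<^sub>0 int) set \<Rightarrow> bool" where
  "coord_generator i y L \<longleftrightarrow> y \<in> L \<and> coord i y > 0 \<and> (\<forall>l\<in>L. coord i y dvd coord i l)"

lemma add_subgroup_slice: "add_subgroup L \<Longrightarrow> add_subgroup (slice i L)"
  by (auto simp: add_subgroup_def slice_def coord_simps)

lemma slice_subset: "slice i L \<subseteq> L"
  by (auto simp: slice_def)

lemma add_subgroup_cmul:
  assumes "add_subgroup L" "x \<in> L"
  shows "frag_cmul k x \<in> L"
proof (induction k rule: int_induct[where k = 0])
  case base
  show ?case using assms add_subgroup_zero by simp
next
  case (step1 k)
  then show ?case using assms add_subgroup_add by (simp add: frag_cmul_distrib)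
next
  case (step2 k)
  then show ?case using assms add_subgroup_diff by (simp add: frag_cmul_diff_distrib)
qed

text \<open>Two of the infinitely many multiples of \<open>x\<close> lie in the same coset; subtract them.\<close>

lemma finite_index_multiple:
  assumes "add_subgroup L" "add_subgroup M" "x \<in> M" "finite (cosets M L)"
  obtains k where "k > 0" "frag_cmul k x \<in> L"
proof -
  let ?c = "\<lambda>n::nat. (+) (frag_cmul (int n) x) ` L"
  have "range ?c \<subseteq> cosets M L"
    using add_subgroup_cmul[OF assms(2,3)] by (auto simp: cosets_def)
  then have "finite (range ?c)" using assms(4) finite_subset by blast
  then have "\<not> inj ?c" using finite_imageD infinite_UNIV_nat by blast
  then obtain a' b' where "?c a' = ?c b'" "a' \<noteq> b'"
    unfolding inj_def by blast
  then obtain a b where ab: "?c b = ?c a" "a < b"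
    by (metis linorder_neq_iff)
  then have "frag_cmul (int b) x - frag_cmul (int a) x \<in> L"
    using coset_eq_iff[OF assms(1)] by blast
  then have "frag_cmul (int b - int a) x \<in> L" by (simp only: frag_cmul_diff_distrib)
  moreover have "int b - int a > 0" using ab(2) by simp
  ultimately show ?thesis using that by blast
qed

text \<open>The \<open>i\<close>-th coordinates of the elements of \<open>L\<close> form a subgroup of \<open>\<int>\<close>, generated by its
least positive element.\<close>

lemma ex_coord_generator:
  assumes L: "add_subgroup L" and l: "l \<in> L" "coord i l \<noteq> 0"
  obtains y where "coord_generator i y L"
proof -
  define P where "P n \<longleftrightarrow> n > 0 \<and> (\<exists>v\<in>L. coord i v = int n)" for n
  have "P (nat \<bar>coord i l\<bar>)"
  proof (cases "coord i l > 0")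
    case False
    then show ?thesis using l add_subgroup_minus[OF L l(1)] coord_simps(3)
      by (auto simp: P_def intro!: bexI[of _ "- l"])
  qed (use l in \<open>auto simp: P_def\<close>)
  then have least: "P (LEAST n. P n)" "\<And>n. P n \<Longrightarrow> (LEAST n. P n) \<le> n"
    by (auto intro: LeastI Least_le)
  then obtain y where y: "y \<in> L" "coord i y = int (LEAST n. P n)" "coord i y > 0"
    unfolding P_def by auto
  have "coord i y dvd coord i v" if v: "v \<in> L" for v
  proof -
    \<comment> \<open>Division with remainder: a nonzero remainder would be a smaller positive coordinate.\<close>
    let ?q = "coord i v div coord i y" and ?r = "coord i v mod coord i y"
    have "v - frag_cmul ?q y \<in> L" using v y add_subgroup_cmul[OF L] add_subgroup_diff[OF L] by blast
    moreover have "coord i (v - frag_cmul ?q y) = ?r"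
      by (simp add: coord_simps minus_div_mult_eq_mod)
    ultimately have "P (nat ?r)" if "?r \<noteq> 0"
      using that y(3) pos_mod_sign[of "coord i y" "coord i v"] unfolding P_def
      by (metis int_nat_eq le_neq_trans zero_less_nat_eq)
    then have "?r = 0"
      using least(2)[of "nat ?r"] y(2,3) pos_mod_bound[of "coord i y" "coord i v"]
      by fastforce
    then show ?thesis by auto
  qed
  with y(1,3) have "coord_generator i y L" unfolding coord_generator_def by blast
  then show ?thesis by (rule that)
qed

lemma coord_generator_decomp:
  assumes L: "add_subgroup L" and y: "coord_generator i y L" and v: "v \<in> L"
  obtains w k where "w \<in> slice i L" "v = w + frag_cmul k y" "coord i v = k * coord i y"
proof -
  obtain k where k: "coord i v = k * coord i y"
    using y v by (metis coord_generator_def dvdE mult.commute)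
  have "v - frag_cmul k y \<in> slice i L"
    using L y v k add_subgroup_cmul[OF L] add_subgroup_diff[OF L]
    by (auto simp: slice_def coord_simps coord_generator_def)
  with k show ?thesis using that[of "v - frag_cmul k y" k] by auto
qed

text \<open>The index splits along the exact sequence given by the \<open>i\<close>-th coordinate into the index \<open>e\<close>
of the images in \<open>\<int>\<close> and the index of the kernels. A transversal consists of the vectors
\<open>t + r x\<close> with \<open>t\<close> in a transversal of the slices and \<open>0 \<le> r < e\<close>.\<close>

lemma index_slice:
  assumes L: "add_subgroup L" and M: "add_subgroup M" and sub: "L \<subseteq> M"
    and x: "coord_generator i x M" and y: "coord_generator i y L"
    and e: "coord i y = int e * coord i x"
  shows "index M L = e * index (slice i M) (slice i L)"
    and "finite (cosets M L) \<longleftrightarrow> finite (cosets (slice i M) (slice i L))"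
proof -
  obtain T where T: "transversal T (slice i M) (slice i L)"
    using ex_transversal add_subgroup_slice[OF L] by metis
  have TM: "t \<in> M" "coord i t = 0" if "t \<in> T" for t
    using T that by (auto simp: transversal_def slice_def)
  have xM: "x \<in> M" and d: "coord i x > 0" and yL: "y \<in> L" and e0: "e > 0"
    using x y e by (auto simp: coord_generator_def zero_less_mult_iff)
  define R where "R = T \<times> {0..<int e}"
  let ?g = "\<lambda>(t, r). t + frag_cmul r x"
  have key: "t = t' \<and> r = r'"
    if *: "(t, r) \<in> R" "(t', r') \<in> R" "?g (t, r) - ?g (t', r') \<in> L" for t r t' r'
  proof -
    have "coord i y dvd coord i (?g (t, r) - ?g (t', r'))"
      using * y by (auto simp: coord_generator_def)
    then have "int e * coord i x dvd (r - r') * coord i x"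
      using * TM by (auto simp: coord_simps R_def e algebra_simps)
    then have "int e dvd r - r'" using d by auto
    then have r: "r = r'" using * zdvd_imp_le[of "int e" "r - r'"] zdvd_imp_le[of "int e" "r' - r"]
      by (auto simp: R_def dvd_diff_commute) (smt (verit))
    then have "t - t' \<in> slice i L" using * TM by (auto simp: slice_def coord_simps R_def)
    moreover have "t - t \<in> slice i L" using add_subgroup_zero[OF add_subgroup_slice[OF L]] by simp
    ultimately have "t = t'" using * T unfolding transversal_def R_def by blast
    with r show ?thesis by simp
  qed
  have inj: "inj_on ?g R"
    using key add_subgroup_zero[OF L] by (force simp: inj_on_def)
  have tr: "transversal (?g ` R) M L"
    unfolding transversal_def
  proof (intro conjI ballI)
    show "?g ` R \<subseteq> M"
      using TM add_subgroup_cmul[OF M xM] add_subgroup_add[OF M] by (auto simp: R_def)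
    fix v assume v: "v \<in> M"
    obtain w c where w: "w \<in> slice i M" "v = w + frag_cmul c x"
      using coord_generator_decomp[OF M x v] by metis
    define q where "q = c div int e"
    define r where "r = c mod int e"
    have c: "c = q * int e + r" by (simp add: q_def r_def)
    \<comment> \<open>\<open>y\<close> and \<open>e x\<close> have the same coordinate, so the multiple of \<open>e\<close> in \<open>c\<close> can be absorbed by \<open>y\<close>.\<close>
    have "w + frag_cmul (q * int e) x - frag_cmul q y \<in> slice i M"
      using w yL sub xM add_subgroup_cmul[OF M] add_subgroup_add[OF M] add_subgroup_diff[OF M]
      by (auto simp: slice_def coord_simps e subset_iff)
    then obtain t where t: "t \<in> T" "w + frag_cmul (q * int e) x - frag_cmul q y - t \<in> slice i L"
      using T unfolding transversal_def by blast
    have "(w + frag_cmul (q * int e) x - frag_cmul q y - t) + frag_cmul q y \<in> L"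
      by (rule add_subgroup_add[OF L subsetD[OF slice_subset t(2)] add_subgroup_cmul[OF L yL]])
    moreover have "(w + frag_cmul (q * int e) x - frag_cmul q y - t) + frag_cmul q y = v - ?g (t, r)"
      by (simp add: w(2) c frag_cmul_distrib)
    ultimately have tL: "v - ?g (t, r) \<in> L" by argo
    have tR: "(t, r) \<in> R" using t e0 by (auto simp: R_def r_def)
    show "\<exists>!u. u \<in> ?g ` R \<and> v - u \<in> L"
    proof (rule ex1I)
      show "?g (t, r) \<in> ?g ` R \<and> v - ?g (t, r) \<in> L" using tR tL by blast
      fix u assume "u \<in> ?g ` R \<and> v - u \<in> L"
      then obtain t' r' where u: "(t', r') \<in> R" "u = ?g (t', r')" "v - u \<in> L" by auto
      have "(v - u) - (v - ?g (t, r)) \<in> L" by (rule add_subgroup_diff[OF L u(3) tL])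
      moreover have "(v - u) - (v - ?g (t, r)) = ?g (t, r) - ?g (t', r')"
        unfolding u(2) by (simp del: minus_frag_cmul)
      ultimately have "?g (t, r) - ?g (t', r') \<in> L" by argo
      then show "u = ?g (t, r)" using key[OF tR u(1)] u(2) by auto
    qed
  qed
  have cT: "index (slice i M) (slice i L) = card T"
    "finite (cosets (slice i M) (slice i L)) \<longleftrightarrow> finite T"
    using index_transversal[OF add_subgroup_slice[OF L] T] by auto
  show "index M L = e * index (slice i M) (slice i L)"
    using index_transversal(1)[OF L tr] inj cT
    by (simp add: card_image card_cartesian_product R_def)
  have "finite R \<longleftrightarrow> finite T" using e0 by (auto simp: R_def finite_cartesian_product_iff)
  then show "finite (cosets M L) \<longleftrightarrow> finite (cosets (slice i M) (slice i L))"
    using index_transversal(2)[OF L tr] finite_image_iff[OF inj] cT by simp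
qed

text \<open>One block of the partition that proves the recursion for the number of sublattices of given
index: the index is constant on it, by \<open>index_slice\<close>.\<close>

definition subgroups_over_slice ::
    "'i \<Rightarrow> ('i \<Rightarrow>\<^sub>0 int) set \<Rightarrow> int \<Rightarrow> ('i \<Rightarrow>\<^sub>0 int) set \<Rightarrow> ('i \<Rightarrow>\<^sub>0 int) set set" where
  "subgroups_over_slice i M c L0 =
     {L. add_subgroup L \<and> L \<subseteq> M \<and> slice i L = L0 \<and> (\<exists>y. coord_generator i y L \<and> coord i y = c)}"

text \<open>Such a subgroup is spanned by \<open>L0\<close> and one vector of the form \<open>e x + t\<close>, where \<open>t\<close> lies in
the slice of \<open>M\<close> and matters only modulo \<open>L0\<close>. This is the freedom in an off-diagonal column of
a Hermite normal form.\<close>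

lemma card_subgroups_over_slice:
  assumes M: "add_subgroup M" and x: "coord_generator i x M" and e: "e > 0"
    and L0: "add_subgroup L0" "L0 \<subseteq> slice i M"
  shows "card (subgroups_over_slice i M (int e * coord i x) L0) = index (slice i M) L0"
    and "finite (cosets (slice i M) L0) \<Longrightarrow>
         finite (subgroups_over_slice i M (int e * coord i x) L0)"
proof -
  obtain T where T: "transversal T (slice i M) L0"
    using ex_transversal[OF L0(1)] by metis
  have xM: "x \<in> M" and d: "coord i x > 0" using x by (auto simp: coord_generator_def)
  define c where "c = int e * coord i x"
  have c0: "c > 0" using e d by (simp add: c_def)
  have TM: "t \<in> M" "coord i t = 0" if "t \<in> T" for t
    using T that by (auto simp: transversal_def slice_def)
  have L0M: "v \<in> M" "coord i v = 0" if "v \<in> L0" for v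
    using L0 that by (auto simp: slice_def)
  let ?y = "\<lambda>t. frag_cmul (int e) x + t"
  define S where "S t = {v + frag_cmul k (?y t) |v k. v \<in> L0}" for t
  have yc: "coord i (?y t) = c" if "t \<in> T" for t
    using TM that by (simp add: coord_simps c_def)
  have yM: "?y t \<in> M" if "t \<in> T" for t
    using TM that add_subgroup_add[OF M] add_subgroup_cmul[OF M xM] by simp
  have SM: "S t \<subseteq> M" if "t \<in> T" for t
    using L0M yM[OF that] add_subgroup_add[OF M] add_subgroup_cmul[OF M] by (auto simp: S_def)
  have coordS: "coord i (v + frag_cmul k (?y t)) = k * c" if "t \<in> T" "v \<in> L0" for t v k
    using yc[OF that(1)] L0M[OF that(2)] by (simp add: coord_simps)
  have zS: "add_subgroup (S t)" for t
    unfolding add_subgroup_def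
  proof (intro conjI ballI)
    show "0 \<in> S t" unfolding S_def using add_subgroup_zero[OF L0(1)]
      by (auto intro!: exI[of _ 0])
    fix a b assume "a \<in> S t" "b \<in> S t"
    then obtain v k w l where ab: "v \<in> L0" "w \<in> L0" "a = v + frag_cmul k (?y t)"
      "b = w + frag_cmul l (?y t)" by (auto simp: S_def)
    then have "a - b = (v - w) + frag_cmul (k - l) (?y t)"
      by (simp add: frag_cmul_diff_distrib)
    then show "a - b \<in> S t" using add_subgroup_diff[OF L0(1)] ab unfolding S_def by blast
  qed
  have yS: "?y t \<in> S t" for t
    unfolding S_def using add_subgroup_zero[OF L0(1)] by (auto intro!: exI[of _ 0] exI[of _ 1])
  have sliceS: "slice i (S t) = L0" if "t \<in> T" for t
  proof
    show "slice i (S t) \<subseteq> L0"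
    proof
      fix a assume "a \<in> slice i (S t)"
      then obtain v k where v: "v \<in> L0" "a = v + frag_cmul k (?y t)" "coord i a = 0"
        by (auto simp: S_def slice_def)
      then have "k = 0" using coordS[OF that v(1)] c0 by simp
      then show "a \<in> L0" using v by simp
    qed
    show "L0 \<subseteq> slice i (S t)"
    proof
      fix a assume a: "a \<in> L0"
      then have "a = a + frag_cmul 0 (?y t)" by simp
      then show "a \<in> slice i (S t)" using a L0M unfolding S_def slice_def by blast
    qed
  qed
  have genS: "coord_generator i (?y t) (S t)" if "t \<in> T" for t
    unfolding coord_generator_def using yS yc[OF that] c0 coordS[OF that]
    by (auto simp: S_def)
  have inj: "inj_on S T"
  proof (rule inj_onI)
    fix s t assume st: "s \<in> T" "t \<in> T" "S s = S t"
    have "?y s \<in> S t" using yS[of s] st(3) by blast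
    from add_subgroup_diff[OF zS this yS[of t]] have "s - t \<in> S t" by simp
    then have "s - t \<in> L0"
      using sliceS[OF st(2)] TM st(1,2) by (auto simp: slice_def coord_simps)
    moreover have "s - s \<in> L0" using add_subgroup_zero[OF L0(1)] by simp
    ultimately show "s = t" using T st(1,2) unfolding transversal_def by blast
  qed
  have img: "S ` T = subgroups_over_slice i M c L0"
  proof
    show "S ` T \<subseteq> subgroups_over_slice i M c L0"
      unfolding subgroups_over_slice_def using zS SM sliceS genS yc by blast
    show "subgroups_over_slice i M c L0 \<subseteq> S ` T"
    proof
      fix L assume "L \<in> subgroups_over_slice i M c L0"
      then obtain y where L: "add_subgroup L" "L \<subseteq> M" "slice i L = L0" and
        y: "coord_generator i y L" "coord i y = c"
        by (auto simp: subgroups_over_slice_def)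
      have yL: "y \<in> L" using y by (simp add: coord_generator_def)
      have "y - frag_cmul (int e) x \<in> slice i M"
        using yL L(2) add_subgroup_diff[OF M] add_subgroup_cmul[OF M xM] y(2)
        by (auto simp: slice_def coord_simps c_def)
      then obtain t where t: "t \<in> T" "y - frag_cmul (int e) x - t \<in> L0"
        using T unfolding transversal_def by blast
      have ytL: "?y t \<in> L"
      proof -
        have "y - (y - frag_cmul (int e) x - t) \<in> L"
          using t(2) L(1,3) yL by (metis slice_subset subsetD add_subgroup_diff)
        then show ?thesis by (simp add: algebra_simps)
      qed
      have gen: "coord_generator i (?y t) L"
        using y ytL yc[OF t(1)] by (simp add: coord_generator_def)
      have "L = S t"
      proof
        show "L \<subseteq> S t"
          using coord_generator_decomp[OF L(1) gen] L(3) unfolding S_def by blast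
        show "S t \<subseteq> L"
          using L(1,3) add_subgroup_add[OF L(1)] add_subgroup_cmul[OF L(1) ytL] slice_subset[of i L]
          by (auto simp: S_def)
      qed
      then show "L \<in> S ` T" using t by blast
    qed
  qed
  note bij = inj img index_transversal[OF L0(1) T]
  show "card (subgroups_over_slice i M (int e * coord i x) L0) = index (slice i M) L0"
    using bij card_image[OF inj] by (simp add: c_def)
  show "finite (subgroups_over_slice i M (int e * coord i x) L0)"
    if "finite (cosets (slice i M) L0)"
    using that bij by (metis c_def finite_imageI)
qed

definition index_subgroups :: "'a::ab_group_add set \<Rightarrow> nat \<Rightarrow> 'a set set" where
  "index_subgroups M n = {L. add_subgroup L \<and> L \<subseteq> M \<and> index M L = n}"

lemma index_subgroups_slices:
  assumes M: "add_subgroup M" and x: "coord_generator i x M" and n: "n > 0"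
  shows "index_subgroups M n =
    (\<Union>(d, L0)\<in>(SIGMA d:{d. d dvd n}. index_subgroups (slice i M) d).
       subgroups_over_slice i M (int (n div d) * coord i x) L0)" (is "_ = ?R")
proof
  have xM: "x \<in> M" and d: "coord i x > 0" using x by (auto simp: coord_generator_def)
  show "index_subgroups M n \<subseteq> ?R"
  proof
    fix L assume "L \<in> index_subgroups M n"
    then have L: "add_subgroup L" "L \<subseteq> M" "index M L = n" by (auto simp: index_subgroups_def)
    then have "finite (cosets M L)" using n by (metis card.infinite less_irrefl)
    then obtain k where k: "k > 0" "frag_cmul k x \<in> L"
      using finite_index_multiple[OF L(1) M xM] by metis
    obtain y where y: "coord_generator i y L"
      using ex_coord_generator[OF L(1) k(2), of i] k(1) d by auto
    have "coord i x dvd coord i y"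
      using x y L(2) by (auto simp: coord_generator_def)
    then obtain c where c: "coord i y = c * coord i x" by (metis dvdE mult.commute)
    moreover have "coord i y > 0" using y by (simp add: coord_generator_def)
    ultimately have "c > 0" using d by (simp add: zero_less_mult_iff)
    then obtain e where e: "coord i y = int e * coord i x" "e > 0"
      using c by (metis zero_less_imp_eq_int)
    let ?d = "index (slice i M) (slice i L)"
    have nd: "n = e * ?d" using index_slice(1)[OF L(1) M L(2) x y e(1)] L(3) by simp
    then have "?d > 0" using n by (cases ?d) auto
    then have "n div ?d = e" "?d dvd n" using nd by (metis nonzero_mult_div_cancel_right less_irrefl, metis dvd_triv_right)
    moreover have "slice i L \<in> index_subgroups (slice i M) ?d"
      using L add_subgroup_slice by (auto simp: index_subgroups_def slice_def)
    moreover have "L \<in> subgroups_over_slice i M (int e * coord i x) (slice i L)"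
      using L y e by (auto simp: subgroups_over_slice_def)
    ultimately show "L \<in> ?R" by blast
  qed
  show "?R \<subseteq> index_subgroups M n"
  proof clarify
    fix L c L0 assume c: "c dvd n" and L0: "L0 \<in> index_subgroups (slice i M) c"
      and L: "L \<in> subgroups_over_slice i M (int (n div c) * coord i x) L0"
    then obtain y where "coord_generator i y L" "coord i y = int (n div c) * coord i x"
      and "add_subgroup L" "L \<subseteq> M" "slice i L = L0"
      by (auto simp: subgroups_over_slice_def)
    then have "index M L = (n div c) * index (slice i M) L0"
      using index_slice(1) M x by metis
    then show "L \<in> index_subgroups M n"
      using c L0 \<open>add_subgroup L\<close> \<open>L \<subseteq> M\<close> by (auto simp: index_subgroups_def)
  qed
qed

text \<open>This is the coefficient of \<open>n\<^sup>-\<^sup>s\<close> in \<open>\<zeta>(s) \<zeta>(s - 1) \<dots> \<zeta>(s - m + 1)\<close>. In the recursion, \<open>d\<close> is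
the index of the slice.\<close>

primrec sublattice_count :: "nat \<Rightarrow> nat \<Rightarrow> nat" where
  "sublattice_count 0 n = (if n = 1 then 1 else 0)"
| "sublattice_count (Suc m) n = (\<Sum>d | d dvd n. d * sublattice_count m d)"

abbreviation std_lattice :: "nat \<Rightarrow> (nat \<Rightarrow>\<^sub>0 int) set" where
  "std_lattice m \<equiv> {v. Poly_Mapping.keys v \<subseteq> {..<m}}"

lemma add_subgroup_lattice: "add_subgroup (std_lattice m)"
  using keys_diff by (fastforce simp: add_subgroup_def)

lemma slice_lattice: "slice m (std_lattice (Suc m)) = std_lattice m"
proof -
  have "Poly_Mapping.keys v \<subseteq> {..<Suc m} \<and> coord m v = 0 \<longleftrightarrow> Poly_Mapping.keys v \<subseteq> {..<m}" for v :: "nat \<Rightarrow>\<^sub>0 int"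
    by (auto simp: subset_iff in_keys_iff less_Suc_eq)
  then show ?thesis by (auto simp: slice_def)
qed

text \<open>Every subgroup of finite index in \<open>\<int>\<^sup>m\<close> has the same number of subgroups of index \<open>n\<close>. The
induction is stated for such subgroups \<open>M\<close> rather than for \<open>\<int>\<^sup>m\<close> alone: slices of \<open>M\<close> are
again of this kind, so that no basis of \<open>M\<close> has to be chosen.\<close>

theorem card_index_subgroups:
  assumes "add_subgroup M" "M \<subseteq> std_lattice m" "finite (cosets (std_lattice m) M)" "n > 0"
  shows "finite (index_subgroups M n) \<and> card (index_subgroups M n) = sublattice_count m n"
  using assms
proof (induction m arbitrary: M n)
  case 0
  have [simp]: "std_lattice 0 = {0}" by auto
  have M: "M = {0}" using 0 add_subgroup_zero by force
  have "index_subgroups M n = (if n = 1 then {{0}} else {})"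
  proof -
    have "L = {0}" if "add_subgroup L" "L \<subseteq> {0}" for L :: "(nat \<Rightarrow>\<^sub>0 int) set"
      using that add_subgroup_zero by force
    moreover have "add_subgroup {0 :: nat \<Rightarrow>\<^sub>0 int}" by (simp add: add_subgroup_def)
    ultimately show ?thesis using finite_index_self[of "{0 :: nat \<Rightarrow>\<^sub>0 int}"]
      unfolding index_subgroups_def M by auto
  qed
  then show ?case by simp
next
  case (Suc m)
  note M = Suc.prems(1)
  \<comment> \<open>Finite index makes the last coordinate nonzero on \<open>M\<close>, so that it has a generator \<open>x\<close>.\<close>
  have "frag_of m \<in> std_lattice (Suc m)" by simp
  then obtain k where "k > 0" "frag_cmul k (frag_of m) \<in> M"
    using finite_index_multiple[OF M add_subgroup_lattice _ Suc.prems(3)] by metis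
  then obtain x where x: "coord_generator m x M"
    using ex_coord_generator[OF M, of "frag_cmul k (frag_of m)" m] by auto
  define M0 where "M0 = slice m M"
  have M0: "add_subgroup M0" "M0 \<subseteq> std_lattice m"
    using add_subgroup_slice[OF M] Suc.prems(2) unfolding M0_def slice_lattice[of m, symmetric] slice_def
    by blast+
  have gen: "coord_generator m (frag_of m) (std_lattice (Suc m))"
    by (simp add: coord_generator_def)
  have "coord m x = int (nat (coord m x)) * coord m (frag_of m)"
    using x by (simp add: coord_generator_def)
  from index_slice(2)[OF M add_subgroup_lattice Suc.prems(2) gen x this]
  have fin0: "finite (cosets (std_lattice m) M0)"
    using Suc.prems(3) by (simp add: slice_lattice M0_def)
  have IH: "finite (index_subgroups M0 d) \<and> card (index_subgroups M0 d) = sublattice_count m d"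
    if "d dvd n" for d
    using Suc.IH[OF M0 fin0] that Suc.prems(4) by (auto intro: Nat.gr0I)
  define I where "I = (SIGMA d:{d. d dvd n}. index_subgroups M0 d)"
  define E where "E = (\<lambda>(d, L0). subgroups_over_slice m M (int (n div d) * coord m x) L0)"
  have finI: "finite I" unfolding I_def using IH Suc.prems(4) by auto
  have eq: "index_subgroups M n = (\<Union>j\<in>I. E j)"
    using index_subgroups_slices[OF M x Suc.prems(4)] by (simp add: I_def E_def M0_def)
  have E: "finite (E j) \<and> card (E j) = fst j" if "j \<in> I" for j
  proof -
    obtain d L0 where j: "j = (d, L0)" "d dvd n" "add_subgroup L0" "L0 \<subseteq> M0" "index M0 L0 = d"
      using \<open>j \<in> I\<close> by (auto simp: I_def index_subgroups_def)
    then have d: "d > 0" "n div d > 0" using Suc.prems(4) by (auto simp: div_greater_zero_iff dvd_imp_le intro: Nat.gr0I)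
    then have "finite (cosets M0 L0)" using j by (metis card.infinite less_irrefl)
    then show ?thesis
      using card_subgroups_over_slice[OF M x d(2) j(3)] j by (auto simp: E_def M0_def)
  qed
  have disj: "E j \<inter> E j' = {}" if "j \<in> I" "j' \<in> I" "j \<noteq> j'" for j j'
    using that by (auto simp: E_def I_def subgroups_over_slice_def index_subgroups_def)
  have "card (index_subgroups M n) = (\<Sum>j\<in>I. fst j)"
    unfolding eq using E disj finI by (subst card_UN_disjoint) auto
  also have "\<dots> = (\<Sum>d | d dvd n. \<Sum>L0\<in>index_subgroups M0 d. d)"
    unfolding I_def using IH Suc.prems(4) by (subst sum.Sigma) (auto intro!: sum.cong)
  also have "\<dots> = sublattice_count (Suc m) n"
    using IH by (auto intro!: sum.cong simp: mult.commute)
  finally show ?case using eq E finI by auto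
qed

section \<open>Surjections with a prescribed kernel\<close>

lemma Sur_iff:
  "f \<in> Sur G H \<longleftrightarrow> f \<in> hom G H \<and> f ` carrier G = carrier H \<and> f \<in> extensional (carrier G)"
  by (auto simp: Sur_def epi_def)

lemma Sur_group_hom: "f \<in> Sur G H \<Longrightarrow> group G \<Longrightarrow> group H \<Longrightarrow> group_hom G H f"
  by (simp add: Sur_iff group_hom_def group_hom_axioms_def)

lemma Sur_image: "f \<in> Sur G H \<Longrightarrow> f ` carrier G = carrier H"
  by (simp add: Sur_iff)

lemma restrict_in_hom:
  assumes "group A" "h \<in> hom A G"
  shows "restrict h (carrier A) \<in> hom A G"
proof -
  interpret group A by fact
  show ?thesis using assms(2) by (simp add: hom_def Pi_def)
qed

lemma hom_eq_iff_kernel: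
  assumes "group_hom G H f" "x \<in> carrier G" "y \<in> carrier G"
  shows "f x = f y \<longleftrightarrow> x \<otimes>\<^bsub>G\<^esub> inv\<^bsub>G\<^esub> y \<in> kernel G H f"
proof -
  interpret group_hom G H f by fact
  have "f x = f y \<longleftrightarrow> f x \<otimes>\<^bsub>H\<^esub> inv\<^bsub>H\<^esub> f y = \<one>\<^bsub>H\<^esub>"
    using assms(2,3) by (simp add: H.inv_solve_right')
  then show ?thesis using assms(2,3) by (simp add: kernel_def)
qed

text \<open>The homomorphism theorem for surjections: those that vanish on the kernel of a fixed
surjection \<open>q\<close> are exactly those that factor, uniquely, through \<open>q\<close>.\<close>

lemma bij_betw_Sur_compose:
  assumes A: "group A" and B: "group B" and F: "group F" and q: "q \<in> Sur A B"
  shows "bij_betw (\<lambda>g. compose (carrier A) g q) (Sur B F)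
           {f \<in> Sur A F. kernel A B q \<subseteq> kernel A F f}"
proof -
  note qi = Sur_image[OF q]
  interpret q: group_hom A B q using Sur_group_hom[OF q A B] .
  have "inj_on (\<lambda>g. compose (carrier A) g q) (Sur B F)"
  proof (rule inj_onI)
    fix g h assume gh: "g \<in> Sur B F" "h \<in> Sur B F"
      "compose (carrier A) g q = compose (carrier A) h q"
    show "g = h"
    proof (rule extensionalityI)
      fix b assume "b \<in> carrier B"
      then obtain a where "a \<in> carrier A" "b = q a" using qi by auto
      then show "g b = h b" using fun_cong[OF gh(3), of a] by (simp add: compose_def)
    qed (use gh in \<open>auto simp: Sur_iff\<close>)
  qed
  moreover have "(\<lambda>g. compose (carrier A) g q) ` Sur B F =
      {f \<in> Sur A F. kernel A B q \<subseteq> kernel A F f}" (is "?l = ?r")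
  proof
    show "?l \<subseteq> ?r"
    proof
      fix f assume "f \<in> ?l"
      then obtain g where g: "g \<in> Sur B F" "f = compose (carrier A) g q" by auto
      interpret g: group_hom B F g using Sur_group_hom[OF g(1) B F] .
      have "f \<in> hom A F" unfolding g(2) by (auto simp: hom_def compose_def)
      moreover have "f ` carrier A = carrier F"
        using surj_compose[OF qi Sur_image[OF g(1)]] by (simp only: g(2))
      moreover have "kernel A B q \<subseteq> kernel A F f"
        by (auto simp: g(2) kernel_def compose_def)
      ultimately show "f \<in> ?r" by (simp add: Sur_iff g(2))
    qed
    show "?r \<subseteq> ?l"
    proof
      fix f assume f: "f \<in> ?r"
      then have fS: "f \<in> Sur A F" by simp
      interpret f: group_hom A F f using Sur_group_hom[OF fS A F] .
      have eq: "f x = f y" if "x \<in> carrier A" "y \<in> carrier A" "q x = q y" for x y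
        using that f hom_eq_iff_kernel[OF q.group_hom_axioms that(1,2)] hom_eq_iff_kernel[OF f.group_hom_axioms that(1,2)]
        by blast
      \<comment> \<open>Well defined by \<open>eq\<close>, whichever preimage of \<open>b\<close> is chosen.\<close>
      define g where "g = restrict (\<lambda>b. f (inv_into (carrier A) q b)) (carrier B)"
      have gq: "g (q a) = f a" if "a \<in> carrier A" for a
      proof -
        have "q a \<in> q ` carrier A" using that by blast
        then have "inv_into (carrier A) q (q a) \<in> carrier A"
          "q (inv_into (carrier A) q (q a)) = q a" by (rule inv_into_into, rule f_inv_into_f)
        from eq[OF this(1) that this(2)] show ?thesis using that by (simp add: g_def)
      qed
      have "g \<in> hom B F"
      proof (rule homI)
        fix x assume "x \<in> carrier B"
        then obtain a where a: "a \<in> carrier A" "x = q a" using qi by auto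
        then show "g x \<in> carrier F" using gq by simp
        fix y assume "y \<in> carrier B"
        then obtain b where b: "b \<in> carrier A" "y = q b" using qi by auto
        show "g (x \<otimes>\<^bsub>B\<^esub> y) = g x \<otimes>\<^bsub>F\<^esub> g y"
          using a b gq[of "a \<otimes>\<^bsub>A\<^esub> b"] by (simp add: gq)
      qed
      moreover have "g ` carrier B = f ` carrier A"
        unfolding qi[symmetric] image_image using gq by (intro image_cong) auto
      ultimately have gS: "g \<in> Sur B F" using Sur_image[OF fS] by (simp add: Sur_iff g_def)
      have "f = compose (carrier A) g q"
      proof (rule extensionalityI)
        show "f \<in> extensional (carrier A)" using fS by (simp add: Sur_iff)
      qed (auto simp: compose_def gq)
      then show "f \<in> ?l" using gS by blast
    qed
  qed
  ultimately show ?thesis by (simp add: bij_betw_def)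
qed

lemma Sur_self_eq_auto:
  assumes "finite (carrier G)"
  shows "Sur G G = auto G"
proof -
  have "inj_on f (carrier G)" if "f ` carrier G = carrier G" for f
    using finite_surj_inj[OF assms, of f] that by simp
  then show ?thesis unfolding Sur_def epi_def auto_def Bij_def bij_betw_def by blast
qed

text \<open>The surjections with the same kernel as \<open>q\<close> form a torsor under the automorphism group.
Factoring through \<open>q\<close> identifies the surjections whose kernel contains that of \<open>q\<close> with the
surjective endomorphisms of \<open>G\<close>; as \<open>G\<close> is finite, these are automorphisms, and then the
kernels coincide.\<close>

lemma card_Sur_same_kernel:
  assumes A: "group A" and G: "group G" and fin: "finite (carrier G)" and q: "q \<in> Sur A G"
  shows "card {f \<in> Sur A G. kernel A G f = kernel A G q} = card (auto G)"
proof -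
  interpret q: group_hom A G q using Sur_group_hom[OF q A G] .
  let ?c = "\<lambda>g. compose (carrier A) g q"
  have bij: "bij_betw ?c (auto G) {f \<in> Sur A G. kernel A G q \<subseteq> kernel A G f}"
    using bij_betw_Sur_compose[OF A G G q] Sur_self_eq_auto[OF fin] by simp
  have "kernel A G (?c g) = kernel A G q" if g: "g \<in> auto G" for g
  proof -
    have gS: "g \<in> Sur G G" using g Sur_self_eq_auto[OF fin] by simp
    interpret g: group_hom G G g using Sur_group_hom[OF gS G G] .
    have "g (q a) = \<one>\<^bsub>G\<^esub> \<longleftrightarrow> q a = \<one>\<^bsub>G\<^esub>" if "a \<in> carrier A" for a
      using g that inj_onD[of g "carrier G" "q a" "\<one>\<^bsub>G\<^esub>"]
      by (auto simp: auto_def Bij_def bij_betw_def)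
    then show ?thesis by (auto simp: kernel_def compose_def)
  qed
  then have "\<forall>f \<in> ?c ` auto G. kernel A G f = kernel A G q" by simp
  then have "\<forall>f \<in> {f \<in> Sur A G. kernel A G q \<subseteq> kernel A G f}. kernel A G f = kernel A G q"
    using bij_betw_imp_surj_on[OF bij] by simp
  then have "{f \<in> Sur A G. kernel A G q \<subseteq> kernel A G f} = {f \<in> Sur A G. kernel A G f = kernel A G q}"
    by blast
  then show ?thesis using bij_betw_same_card[OF bij] by simp
qed

lemma ex_Sur_kernel_iff:
  assumes A: "group A" and G: "group G" and N: "N \<lhd> A"
  shows "(\<exists>q\<in>Sur A G. kernel A G q = N) \<longleftrightarrow> A Mod N \<cong> G"
proof
  assume "\<exists>q\<in>Sur A G. kernel A G q = N"
  then obtain q where q: "q \<in> Sur A G" "kernel A G q = N" by (rule bexE)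
  have "A Mod kernel A G q \<cong> G"
    by (rule group_hom.FactGroup_iso[OF Sur_group_hom[OF q(1) A G] Sur_image[OF q(1)]])
  then show "A Mod N \<cong> G" by (simp only: q(2))
next
  assume "A Mod N \<cong> G"
  then obtain h where h: "h \<in> iso (A Mod N) G" by (auto simp: is_iso_def)
  interpret N: normal N A by fact
  interpret M: group "A Mod N" by (rule N.factorgroup_is_group)
  define q where "q = restrict (\<lambda>a. h (N #>\<^bsub>A\<^esub> a)) (carrier A)"
  have car: "carrier (A Mod N) = (\<lambda>x. N #>\<^bsub>A\<^esub> x) ` carrier A" by (rule carrier_FactGroup)
  have hh: "h \<in> hom (A Mod N) G" and hb: "bij_betw h (carrier (A Mod N)) (carrier G)"
    using h by (auto simp: iso_def)
  have mem: "N #>\<^bsub>A\<^esub> a \<in> carrier (A Mod N)" if "a \<in> carrier A" for a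
    using that car by blast
  have "q \<in> hom A G"
  proof (rule homI)
    fix x y assume xy: "x \<in> carrier A" "y \<in> carrier A"
    show "q x \<in> carrier G" using hh mem[OF xy(1)] xy by (simp add: q_def hom_carrier hom_in_carrier)
    have "N #>\<^bsub>A\<^esub> (x \<otimes>\<^bsub>A\<^esub> y) = (N #>\<^bsub>A\<^esub> x) \<otimes>\<^bsub>A Mod N\<^esub> (N #>\<^bsub>A\<^esub> y)"
      using N.rcos_sum xy by simp
    then show "q (x \<otimes>\<^bsub>A\<^esub> y) = q x \<otimes>\<^bsub>G\<^esub> q y"
      using hom_mult[OF hh mem[OF xy(1)] mem[OF xy(2)]] xy by (simp add: q_def)
  qed
  moreover have "q ` carrier A = carrier G"
    using hb unfolding bij_betw_def car by (auto simp: q_def)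
  ultimately have qS: "q \<in> Sur A G" by (simp add: Sur_iff q_def)
  have "q a = \<one>\<^bsub>G\<^esub> \<longleftrightarrow> a \<in> N" if a: "a \<in> carrier A" for a
  proof -
    have h1: "h N = \<one>\<^bsub>G\<^esub>" using hom_one[OF hh M.is_group G] by simp
    have "q a = \<one>\<^bsub>G\<^esub> \<longleftrightarrow> h (N #>\<^bsub>A\<^esub> a) = h N" using a h1 by (simp add: q_def)
    also have "\<dots> \<longleftrightarrow> N #>\<^bsub>A\<^esub> a = N"
      using inj_on_eq_iff[of h "carrier (A Mod N)" "N #>\<^bsub>A\<^esub> a" N] hb mem[OF a] M.one_closed
      by (simp add: bij_betw_def)
    also have "\<dots> \<longleftrightarrow> a \<in> N"
      using a N.rcos_const N.rcos_self by (metis N.subgroup_axioms A group.rcos_self)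
    finally show ?thesis .
  qed
  then have "kernel A G q = N" using N.subset by (auto simp: kernel_def)
  then show "\<exists>q\<in>Sur A G. kernel A G q = N" using qS by blast
qed

text \<open>The common source of the factor \<open>#Aut\<close> in both sums: it is applied with \<open>A = \<int>\<^sup>m\<close> on the
left side and with \<open>A = F1\<close> on the right side.\<close>

lemma card_Sur_kernel:
  assumes A: "group A" and G: "group G" "finite (carrier G)" and N: "N \<lhd> A"
  shows "card {f \<in> Sur A G. kernel A G f = N} = (if A Mod N \<cong> G then card (auto G) else 0)"
proof (cases "A Mod N \<cong> G")
  case True
  then obtain q where q: "q \<in> Sur A G" "kernel A G q = N"
    unfolding ex_Sur_kernel_iff[OF A G(1) N, symmetric] by (rule bexE)
  show ?thesis using card_Sur_same_kernel[OF A G q(1)] True by (simp only: q(2) if_True)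
next
  case False
  then have "{f \<in> Sur A G. kernel A G f = N} = {}"
    using ex_Sur_kernel_iff[OF A G(1) N] by blast
  then show ?thesis using False by (simp only: card.empty if_False)
qed

section \<open>Homomorphisms from a free abelian group of finite rank\<close>

abbreviation Zn :: "nat \<Rightarrow> (nat \<Rightarrow>\<^sub>0 int) monoid" where
  "Zn m \<equiv> free_Abelian_group {..<m}"

lemma carrier_Zn: "carrier (Zn m) = std_lattice m"
  by (simp add: free_Abelian_group_def)

lemma subgroup_Zn_iff: "subgroup L (Zn m) \<longleftrightarrow> add_subgroup L \<and> L \<subseteq> std_lattice m"
proof
  assume L: "subgroup L (Zn m)"
  interpret subgroup L "Zn m" by fact
  have sub: "L \<subseteq> std_lattice m" using subset by (simp only: carrier_Zn)
  have "x - y \<in> L" if "x \<in> L" "y \<in> L" for x y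
  proof -
    have "Poly_Mapping.keys y \<subseteq> {..<m}" using sub that(2) by blast
    then show ?thesis using m_closed[OF that(1) m_inv_closed[OF that(2)]] by simp
  qed
  moreover have "0 \<in> L" using one_closed by simp
  ultimately show "add_subgroup L \<and> L \<subseteq> std_lattice m" using sub unfolding add_subgroup_def by blast
next
  assume L: "add_subgroup L \<and> L \<subseteq> std_lattice m"
  show "subgroup L (Zn m)"
  proof (rule group.subgroupI[OF group_free_Abelian_group])
    show "L \<subseteq> carrier (Zn m)" using L by (simp only: carrier_Zn)
    show "L \<noteq> {}" using L add_subgroup_zero by blast
    fix a b assume ab: "a \<in> L" "b \<in> L"
    then have "Poly_Mapping.keys a \<subseteq> {..<m}" using L by blast
    then show "inv\<^bsub>Zn m\<^esub> a \<in> L" using add_subgroup_minus[of L a] L ab by simp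
    show "a \<otimes>\<^bsub>Zn m\<^esub> b \<in> L" using add_subgroup_add[of L a b] L ab by simp
  qed
qed

lemma normal_Zn:
  assumes "add_subgroup L" "L \<subseteq> std_lattice m" shows "L \<lhd> Zn m"
proof -
  interpret comm_group "Zn m" by (rule abelian_free_Abelian_group)
  show ?thesis unfolding normal_iff_subgroup subgroup_Zn_iff using assms by (rule conjI)
qed

lemma carrier_Zn_Mod: "carrier (Zn m Mod L) = cosets (std_lattice m) L"
proof -
  have "L #>\<^bsub>Zn m\<^esub> x = (+) x ` L" for x
    by (auto simp: r_coset_def add.commute)
  then show ?thesis unfolding carrier_FactGroup carrier_Zn cosets_def by simp
qed

lemma kernel_Zn:
  assumes F: "group F" and f: "f \<in> Sur (Zn m) F"
  shows "add_subgroup (kernel (Zn m) F f)" "kernel (Zn m) F f \<subseteq> std_lattice m"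
    "index (std_lattice m) (kernel (Zn m) F f) = card (carrier F)"
    "finite (carrier F) \<Longrightarrow> finite (cosets (std_lattice m) (kernel (Zn m) F f))"
proof -
  interpret f: group_hom "Zn m" F f by (rule Sur_group_hom[OF f group_free_Abelian_group F])
  show "add_subgroup (kernel (Zn m) F f)" "kernel (Zn m) F f \<subseteq> std_lattice m"
    using f.subgroup_kernel unfolding subgroup_Zn_iff by (rule conjunct1, rule conjunct2)
  have iso: "Zn m Mod kernel (Zn m) F f \<cong> F" by (rule f.FactGroup_iso[OF Sur_image[OF f]])
  show "index (std_lattice m) (kernel (Zn m) F f) = card (carrier F)"
    using iso_same_card[OF iso] by (simp add: carrier_Zn_Mod)
  show "finite (cosets (std_lattice m) (kernel (Zn m) F f))" if "finite (carrier F)"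
    using iso_finite[OF iso] that by (simp add: carrier_Zn_Mod)
qed

text \<open>Extensional like \<open>Sur\<close>, so that homomorphisms are counted once.\<close>

definition Hom :: "('a, 'c) monoid_scheme \<Rightarrow> ('b, 'd) monoid_scheme \<Rightarrow> ('a \<Rightarrow> 'b) set" where
  "Hom G H = hom G H \<inter> extensional (carrier G)"

lemma bij_betw_Hom_Zn:
  assumes G: "comm_group G"
  shows "bij_betw (\<lambda>f. restrict (f \<circ> frag_of) {..<m}) (Hom (Zn m) G) ({..<m} \<rightarrow>\<^sub>E carrier G)"
proof -
  interpret comm_group G by fact
  let ?r = "\<lambda>f. restrict (f \<circ> frag_of) {..<m}"
  have mem: "frag_of i \<in> carrier (Zn m)" if "i < m" for i using that by simp
  have "inj_on ?r (Hom (Zn m) G)"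
  proof (rule inj_onI)
    fix f g assume fg: "f \<in> Hom (Zn m) G" "g \<in> Hom (Zn m) G" "?r f = ?r g"
    then have hom: "f \<in> hom (Zn m) G" "g \<in> hom (Zn m) G"
      and ext: "f \<in> extensional (carrier (Zn m))" "g \<in> extensional (carrier (Zn m))"
      by (auto simp: Hom_def)
    interpret f: group_hom "Zn m" G f
      using hom(1) is_group by (simp add: group_hom_def group_hom_axioms_def)
    interpret g: group_hom "Zn m" G g
      using hom(2) is_group by (simp add: group_hom_def group_hom_axioms_def)
    have eq: "f (frag_of i) = g (frag_of i)" if "i < m" for i
      using fun_cong[OF fg(3), of i] that by simp
    have "f x = g x" if "Poly_Mapping.keys x \<subseteq> {..<m}" for x
      using that
    proof (rule free_Abelian_group_induct)
      show "f 0 = g 0" using f.hom_one g.hom_one by simp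
      show "f (frag_of i) = g (frag_of i)" if "i \<in> {..<m}" for i using eq that by simp
      fix x y
      assume k: "Poly_Mapping.keys x \<subseteq> {..<m}" "Poly_Mapping.keys y \<subseteq> {..<m}"
        and IH: "f x = g x" "f y = g y"
      have xy: "x \<in> carrier (Zn m)" "y \<in> carrier (Zn m)" using k by simp_all
      have xy': "inv\<^bsub>Zn m\<^esub> y \<in> carrier (Zn m)" by (rule f.G.inv_closed[OF xy(2)])
      have d: "x - y = x \<otimes>\<^bsub>Zn m\<^esub> inv\<^bsub>Zn m\<^esub> y" using k(2) by simp
      show "f (x - y) = g (x - y)"
        unfolding d f.hom_mult[OF xy(1) xy'] g.hom_mult[OF xy(1) xy']
          f.hom_inv[OF xy(2)] g.hom_inv[OF xy(2)] IH ..
    qed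
    then show "f = g" using ext by (intro extensionalityI[OF ext]) simp
  qed
  moreover have "?r ` Hom (Zn m) G = {..<m} \<rightarrow>\<^sub>E carrier G"
  proof
    show "?r ` Hom (Zn m) G \<subseteq> {..<m} \<rightarrow>\<^sub>E carrier G"
    proof
      fix g assume "g \<in> ?r ` Hom (Zn m) G"
      then obtain f where f: "f \<in> hom (Zn m) G" "g = ?r f" unfolding Hom_def by blast
      have "f (frag_of i) \<in> carrier G" if "i < m" for i
        by (rule hom_in_carrier[OF f(1) mem[OF that]])
      then show "g \<in> {..<m} \<rightarrow>\<^sub>E carrier G" by (simp add: f(2))
    qed
    show "{..<m} \<rightarrow>\<^sub>E carrier G \<subseteq> ?r ` Hom (Zn m) G"
    proof
      fix g assume g: "g \<in> {..<m} \<rightarrow>\<^sub>E carrier G"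
      then have "g ` {..<m} \<subseteq> carrier G" by auto
      from free_Abelian_group_universal[OF this]
      obtain h where h: "h \<in> hom (Zn m) G" "\<And>i. i \<in> {..<m} \<Longrightarrow> h (frag_of i) = g i"
        by metis
      have "restrict h (carrier (Zn m)) \<in> Hom (Zn m) G"
        using restrict_in_hom[OF group_free_Abelian_group h(1)] by (simp add: Hom_def)
      moreover have "g = ?r (restrict h (carrier (Zn m)))"
      proof (rule extensionalityI)
        show "g \<in> extensional {..<m}" using g by (simp add: PiE_def)
      qed (use h(2) in auto)
      ultimately show "g \<in> ?r ` Hom (Zn m) G" by blast
    qed
  qed
  ultimately show ?thesis by (simp add: bij_betw_def)
qed

lemma card_Hom_Zn:
  assumes "comm_group G"
  shows "card (Hom (Zn m) G) = card (carrier G) ^ m"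
    and "finite (carrier G) \<Longrightarrow> finite (Hom (Zn m) G)"
proof -
  note bij = bij_betw_Hom_Zn[OF assms, of m]
  show "card (Hom (Zn m) G) = card (carrier G) ^ m"
    unfolding bij_betw_same_card[OF bij] by (simp add: card_PiE)
  show "finite (Hom (Zn m) G)" if "finite (carrier G)"
    unfolding bij_betw_finite[OF bij] using that by (intro finite_PiE) auto
qed

lemma Sur_subset_Hom: "Sur G H \<subseteq> Hom G H"
  by (auto simp: Sur_iff Hom_def)

lemma finite_Sur_Zn: "comm_group G \<Longrightarrow> finite (carrier G) \<Longrightarrow> finite (Sur (Zn m) G)"
  by (rule finite_subset[OF Sur_subset_Hom card_Hom_Zn(2)])

text \<open>A homomorphism from \<open>\<int>\<^sup>m\<close> that is not surjective maps into one of the finitely many proper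
subgroups \<open>H\<close>, and the proportion of those is \<open>(#H / #G)\<^sup>m\<close>.\<close>

lemma Sur_Zn_density:
  assumes G: "comm_group G" and fin: "finite (carrier G)"
  shows "(\<lambda>m. real (card (Sur (Zn m) G)) / real (card (carrier G)) ^ m) \<longlonglongrightarrow> 1"
proof -
  interpret comm_group G by fact
  define c where "c = real (card (carrier G))"
  define \<H> where "\<H> = {H. subgroup H G \<and> H \<noteq> carrier G}"
  have finH: "finite \<H>"
    unfolding \<H>_def by (rule finite_subset[of _ "Pow (carrier G)"]) (use fin subgroup.subset in auto)
  have c0: "c > 0" unfolding c_def using fin one_closed card_gt_0_iff by auto
  have lower: "1 - (\<Sum>H\<in>\<H>. (real (card H) / c) ^ m) \<le> real (card (Sur (Zn m) G)) / c ^ m" for m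
  proof -
    have "Hom (Zn m) G \<subseteq> Sur (Zn m) G \<union> (\<Union>H\<in>\<H>. Hom (Zn m) (G\<lparr>carrier := H\<rparr>))"
    proof
      fix f assume f: "f \<in> Hom (Zn m) G"
      interpret f: group_hom "Zn m" G f
        using f is_group by (simp add: Hom_def group_hom_def group_hom_axioms_def)
      let ?H = "f ` carrier (Zn m)"
      show "f \<in> Sur (Zn m) G \<union> (\<Union>H\<in>\<H>. Hom (Zn m) (G\<lparr>carrier := H\<rparr>))"
      proof (cases "?H = carrier G")
        case True
        then show ?thesis using f by (auto simp: Sur_iff Hom_def)
      next
        case False
        then have "?H \<in> \<H>" using f.img_is_subgroup by (simp add: \<H>_def)
        moreover have "f \<in> Hom (Zn m) (G\<lparr>carrier := ?H\<rparr>)"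
          using f by (auto simp: Hom_def hom_def)
        ultimately show ?thesis by blast
      qed
    qed
    moreover have sub: "comm_group (G\<lparr>carrier := H\<rparr>)" "finite (carrier (G\<lparr>carrier := H\<rparr>))" if "H \<in> \<H>" for H
    proof -
      have H: "subgroup H G" using that by (simp add: \<H>_def)
      show "comm_group (G\<lparr>carrier := H\<rparr>)" 
        by (rule group.group_comm_groupI[OF subgroup.subgroup_is_group[OF H is_group]])
          (use subgroup.subset[OF H] m_comm in \<open>simp add: subset_iff\<close>)
      show "finite (carrier (G\<lparr>carrier := H\<rparr>))"
        using finite_subset[OF subgroup.subset[OF H] fin] by simp
    qed
    moreover have "finite (Sur (Zn m) G \<union> (\<Union>H\<in>\<H>. Hom (Zn m) (G\<lparr>carrier := H\<rparr>)))"
      by (intro finite_UnI finite_UN_I finH card_Hom_Zn(2) sub finite_Sur_Zn G fin)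
    ultimately have "card (Hom (Zn m) G) \<le> card (Sur (Zn m) G \<union> (\<Union>H\<in>\<H>. Hom (Zn m) (G\<lparr>carrier := H\<rparr>)))"
      by (intro card_mono)
    also have "\<dots> \<le> card (Sur (Zn m) G) + card (\<Union>H\<in>\<H>. Hom (Zn m) (G\<lparr>carrier := H\<rparr>))"
      by (rule card_Un_le)
    also have "\<dots> \<le> card (Sur (Zn m) G) + (\<Sum>H\<in>\<H>. card (Hom (Zn m) (G\<lparr>carrier := H\<rparr>)))"
      by (intro add_left_mono card_UN_le finH)
    also have "\<dots> = card (Sur (Zn m) G) + (\<Sum>H\<in>\<H>. card H ^ m)"
      using card_Hom_Zn(1)[OF sub(1)] by simp
    finally have "card (carrier G) ^ m \<le> card (Sur (Zn m) G) + (\<Sum>H\<in>\<H>. card H ^ m)"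
      by (simp add: card_Hom_Zn(1)[OF G])
    then have "real (card (carrier G) ^ m) \<le> real (card (Sur (Zn m) G) + (\<Sum>H\<in>\<H>. card H ^ m))"
      by (rule of_nat_mono)
    then have "c ^ m \<le> real (card (Sur (Zn m) G)) + (\<Sum>H\<in>\<H>. real (card H) ^ m)"
      by (simp add: c_def)
    then have "c ^ m / c ^ m \<le> (real (card (Sur (Zn m) G)) + (\<Sum>H\<in>\<H>. real (card H) ^ m)) / c ^ m"
      using c0 by (intro divide_right_mono) auto
    then show ?thesis using c0 by (simp add: add_divide_distrib sum_divide_distrib power_divide)
  qed
  have upper: "real (card (Sur (Zn m) G)) / c ^ m \<le> 1" for m
  proof -
    have "card (Sur (Zn m) G) \<le> card (carrier G) ^ m"
      using card_mono[OF card_Hom_Zn(2)[OF G fin] Sur_subset_Hom, of m] card_Hom_Zn(1)[OF G, of m] by simp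
    then have "real (card (Sur (Zn m) G)) \<le> real (card (carrier G) ^ m)" by (rule of_nat_mono)
    then show ?thesis using c0 by (simp add: c_def)
  qed
  have lim: "(\<lambda>m. 1 - (\<Sum>H\<in>\<H>. (real (card H) / c) ^ m)) \<longlonglongrightarrow> 1 - (\<Sum>H\<in>\<H>. 0)"
  proof (intro tendsto_diff tendsto_const tendsto_sum LIMSEQ_power_zero)
    fix H assume "H \<in> \<H>"
    then have "H \<subset> carrier G" using subgroup.subset by (auto simp: \<H>_def)
    then have "card H < card (carrier G)" using fin by (rule psubset_card_mono[rotated])
    then show "norm (real (card H) / c) < 1" using c0 by (simp add: c_def)
  qed
  show ?thesis unfolding c_def[symmetric]
    by (rule tendsto_sandwich[OF always_eventually always_eventually _ tendsto_const])
      (use lower upper lim in auto)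
qed

section \<open>The generating series of the sublattice counts\<close>

text \<open>For \<open>G\<close> of order \<open>p\<^sup>n\<close> the denominator is the number of all homomorphisms from \<open>\<int>\<^sup>m\<close> to
\<open>G\<close>, so dividing by it turns counts of surjections into densities. It makes the sequence converge in \<open>m\<close>.\<close>

definition sublattice_series :: "nat \<Rightarrow> nat \<Rightarrow> nat \<Rightarrow> real" where
  "sublattice_series p m n = real (sublattice_count m (p ^ n)) / real p ^ (n * m)"

lemma sublattice_series_0: "p > 1 \<Longrightarrow> sublattice_series p 0 n = (if n = 0 then 1 else 0)"
  by (simp add: sublattice_series_def)

text \<open>The divisors of \<open>p\<^sup>n\<close> are the powers \<open>p\<^sup>i\<close> with \<open>i \<le> n\<close>, so the divisor sum becomes a
Cauchy product with a geometric series of ratio \<open>p\<^sup>-\<^sup>m\<^sup>-\<^sup>1\<close>.\<close>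

lemma sublattice_series_Suc:
  assumes p: "Factorial_Ring.prime p"
  shows "sublattice_series p (Suc m) n =
    (\<Sum>i\<le>n. sublattice_series p m i * (1 / real p ^ Suc m) ^ (n - i))"
proof -
  have p0: "real p \<noteq> 0" "p > 1" using p prime_gt_1_nat by (auto simp: prime_gt_0_nat)
  have inj: "inj_on ((^) p) {..n}"
    using p0(2) by (auto simp: inj_on_def power_inject_exp)
  have div: "{d. d dvd p ^ n} = (^) p ` {..n}"
    using divides_primepow_nat[OF p] by auto
  have "sublattice_series p (Suc m) n =
      (\<Sum>i\<le>n. real (p ^ i * sublattice_count m (p ^ i))) / real p ^ (n * Suc m)"
    unfolding sublattice_series_def sublattice_count.simps(2) div sum.reindex[OF inj] by simp
  also have "\<dots> = (\<Sum>i\<le>n. sublattice_series p m i * (1 / real p ^ Suc m) ^ (n - i))"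
    unfolding sum_divide_distrib
  proof (intro sum.cong refl)
    fix i assume "i \<in> {..n}"
    then obtain k where k: "n = i + k" by (auto simp: le_iff_add)
    have "real p ^ (n * Suc m) = real p ^ i * real p ^ (i * m) * real p ^ (Suc m * k)"
      unfolding k power_add[symmetric] by (simp add: algebra_simps)
    moreover have "(1 / real p ^ Suc m) ^ (n - i) = 1 / real p ^ (Suc m * k)"
      by (simp only: k power_one_over power_mult diff_add_inverse)
    ultimately show "real (p ^ i * sublattice_count m (p ^ i)) / real p ^ (n * Suc m) =
        sublattice_series p m i * (1 / real p ^ Suc m) ^ (n - i)"
      using p0 by (simp add: sublattice_series_def)
  qed
  finally show ?thesis .
qed

lemma sublattice_series_nonneg: "sublattice_series p m n \<ge> 0"
  by (simp add: sublattice_series_def)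

lemma sublattice_series_mono:
  assumes "Factorial_Ring.prime p"
  shows "sublattice_series p m n \<le> sublattice_series p (Suc m) n"
  unfolding sublattice_series_Suc[OF assms]
  using member_le_sum[of n "{..n}" "\<lambda>i. sublattice_series p m i * (1 / real p ^ Suc m) ^ (n - i)"]
  by (simp add: sublattice_series_nonneg)

lemma sublattice_series_sums:
  assumes p: "Factorial_Ring.prime p"
  shows "sublattice_series p m sums (1 / (\<Prod>i<m. 1 - 1 / real p ^ Suc i))"
proof (induction m)
  case 0
  have "(\<lambda>n. if n = 0 then 1 else 0 :: real) sums 1" using sums_single[of 0 "\<lambda>_. 1::real"] by simp
  moreover have "sublattice_series p 0 = (\<lambda>n. if n = 0 then 1 else 0)"
    using sublattice_series_0[OF prime_gt_1_nat[OF p]] by (rule ext)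
  ultimately show ?case by simp
next
  case (Suc m)
  let ?x = "1 / real p ^ Suc m"
  have x: "norm ?x < 1" using prime_gt_1_nat[OF p] by (simp add: one_less_power del: power_Suc)
  have g: "(\<lambda>k. ?x ^ k) sums (1 / (1 - ?x))" by (rule geometric_sums[OF x])
  have "(\<lambda>n. \<Sum>i\<le>n. sublattice_series p m i * ?x ^ (n - i)) sums
      (suminf (sublattice_series p m) * suminf (\<lambda>k. ?x ^ k))"
  proof (rule Cauchy_product_sums)
    show "summable (\<lambda>k. norm (sublattice_series p m k))"
      using Suc sums_summable by (simp add: sublattice_series_nonneg)
    show "summable (\<lambda>k. norm (?x ^ k))"
      unfolding norm_power by (rule summable_geometric) (use x in simp)
  qed
  then show ?case
    unfolding sublattice_series_Suc[OF p, symmetric] sums_unique[OF Suc, symmetric]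
      sums_unique[OF g, symmetric] by (simp add: mult.commute)
qed

lemma c0_limit:
  assumes p: "Factorial_Ring.prime p"
  shows "(\<lambda>m. \<Prod>i<m. 1 - 1 / real p ^ Suc i) \<longlonglongrightarrow> c0 p" and "c0 p > 0"
    and "(\<Prod>i<m. 1 - 1 / real p ^ Suc i) \<ge> c0 p"
proof -
  let ?f = "\<lambda>i. 1 - 1 / real p ^ Suc i"
  have p1: "real p > 1" using prime_gt_1_nat[OF p] by simp
  have lt: "1 / real p ^ Suc i < 1" "1 / real p ^ Suc i > 0" for i
    using p1 one_less_power[OF p1, of "Suc i"] by (simp_all del: power_Suc)
  have "summable (\<lambda>i. (1 / real p) ^ Suc i)"
    unfolding summable_Suc_iff by (rule summable_geometric) (use p1 in simp)
  then have "summable (\<lambda>i. norm (?f i - 1))"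
    using p1 by (simp add: power_one_over del: power_Suc)
  then have "abs_convergent_prod ?f" by (rule summable_imp_abs_convergent_prod)
  then have "convergent_prod ?f" by (rule abs_convergent_prod_imp_convergent_prod)
  then have hp: "?f has_prod c0 p" unfolding c0_def by (rule convergent_prod_has_prod)
  show lim: "(\<lambda>m. \<Prod>i<m. ?f i) \<longlonglongrightarrow> c0 p" by (rule has_prod_imp_tendsto'[OF hp])
  show "c0 p > 0" by (rule has_prod_pos[OF hp]) (use lt in simp)
  have "decseq (\<lambda>m. \<Prod>i<m. ?f i)"
  proof (rule decseq_SucI)
    fix m
    have "(\<Prod>i<m. ?f i) \<ge> 0" by (intro prod_nonneg) (use lt(1) in \<open>simp add: less_eq_real_def del: power_Suc\<close>)
    then show "(\<Prod>i<Suc m. ?f i) \<le> (\<Prod>i<m. ?f i)"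
      using mult_left_mono[of "?f m" 1 "\<Prod>i<m. ?f i"] lt[of m] by simp
  qed
  from decseq_ge[OF this lim] show "(\<Prod>i<m. ?f i) \<ge> c0 p" .
qed

text \<open>Exchange of the limit in \<open>m\<close> with the sum over \<open>n\<close>, by monotone convergence: the series
increase with \<open>m\<close>, and their sums are bounded by \<open>1 / c0\<close>, to which they converge.\<close>

lemma sublattice_series_limit_sums:
  assumes p: "Factorial_Ring.prime p" and v: "\<And>n. (\<lambda>m. sublattice_series p m n) \<longlonglongrightarrow> v n"
  shows "v sums (1 / c0 p)"
proof -
  let ?P = "\<lambda>m. \<Prod>i<m. 1 - 1 / real p ^ Suc i"
  note c0 = c0_limit[OF p]
  have v0: "v n \<ge> 0" for n
    using LIMSEQ_le_const[OF v] sublattice_series_nonneg by blast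
  have le_v: "sublattice_series p m n \<le> v n" for m n
    by (rule incseq_le[OF incseq_SucI v]) (rule sublattice_series_mono[OF p])
  have part: "sum v {..<N} \<le> 1 / c0 p" for N
  proof (rule LIMSEQ_le_const2)
    show "(\<lambda>m. \<Sum>n<N. sublattice_series p m n) \<longlonglongrightarrow> sum v {..<N}"
      by (intro tendsto_sum v)
    have "(\<Sum>n<N. sublattice_series p m n) \<le> 1 / c0 p" for m
    proof -
      have s: "sublattice_series p m sums (1 / ?P m)" by (rule sublattice_series_sums[OF p])
      have "(\<Sum>n<N. sublattice_series p m n) \<le> 1 / ?P m"
        using sum_le_suminf[OF sums_summable[OF s], of "{..<N}"] sublattice_series_nonneg
          sums_unique[OF s] by simp
      also have "\<dots> \<le> 1 / c0 p" using c0(2) c0(3)[of m] by (intro divide_left_mono mult_pos_pos) auto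
      finally show ?thesis .
    qed
    then show "\<exists>M. \<forall>m\<ge>M. (\<Sum>n<N. sublattice_series p m n) \<le> 1 / c0 p" by blast
  qed
  have sm: "summable v"
    by (rule bounded_imp_summable[where B = "1 / c0 p"]) (use v0 part[of "Suc _"] in \<open>auto simp: lessThan_Suc_atMost\<close>)
  have "suminf v \<le> 1 / c0 p" using suminf_le_const[OF sm] part by blast
  moreover have "1 / c0 p \<le> suminf v"
  proof (rule LIMSEQ_le_const2)
    show "(\<lambda>m. 1 / ?P m) \<longlonglongrightarrow> 1 / c0 p"
      using c0(1,2) by (intro tendsto_divide tendsto_const) auto
    have "1 / ?P m \<le> suminf v" for m
      by (rule sums_le[OF le_v sublattice_series_sums[OF p] summable_sums[OF sm]])
    then show "\<exists>M. \<forall>m\<ge>M. 1 / ?P m \<le> suminf v" by blast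
  qed
  ultimately show ?thesis using sm by (simp add: sums_iff)
qed

section \<open>All surjection moments are equal\<close>

text \<open>For a fixed order only finitely many isomorphism classes occur, so that the limit
\<open>m \<rightarrow> \<infinity>\<close> can be taken in finite sums; the sum over all orders comes last.\<close>

definition p_reps :: "nat \<Rightarrow> nat \<Rightarrow> nat monoid set" where
  "p_reps p k = {G \<in> iso_reps p. card (carrier G) = p ^ k}"

lemma p_reps_group:
  assumes "G \<in> p_reps p k"
  shows "G \<in> iso_reps p" "comm_group G" "group G" "finite (carrier G)" "card (carrier G) = p ^ k"
proof -
  show "G \<in> iso_reps p" "card (carrier G) = p ^ k" using assms by (simp_all add: p_reps_def)
  then have "finite_abelian_p_group p G" using iso_reps_subset by (auto simp: nat_p_groups_def)
  then show "comm_group G" "finite (carrier G)" by (simp_all add: finite_abelian_p_group_def)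
  then show "group G" by (simp add: comm_group.axioms(2))
qed

lemma card_auto_pos:
  assumes "group G" "finite (carrier G)"
  shows "card (auto G) > 0"
proof -
  have "auto G \<subseteq> carrier G \<rightarrow>\<^sub>E carrier G"
    by (auto simp: auto_def Bij_def PiE_def hom_def)
  then have "finite (auto G)"
    by (rule finite_subset) (intro finite_PiE assms(2))
  moreover have "(\<lambda>x\<in>carrier G. x) \<in> auto G" by (rule group.id_in_auto[OF assms(1)])
  ultimately show ?thesis using card_gt_0_iff by blast
qed

lemma ex1_quotient_rep:
  assumes p: "p > 0" and L: "L \<in> index_subgroups (std_lattice m) (p ^ k)"
  shows "\<exists>!G. G \<in> p_reps p k \<and> Zn m Mod L \<cong> G"
proof -
  interpret comm_group "Zn m" by (rule abelian_free_Abelian_group)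
  have L': "add_subgroup L" "L \<subseteq> std_lattice m" "index (std_lattice m) L = p ^ k"
    using L by (simp_all add: index_subgroups_def)
  have ord: "card (carrier (Zn m Mod L)) = p ^ k"
    by (simp only: carrier_Zn_Mod L'(3))
  have "subgroup L (Zn m)" unfolding subgroup_Zn_iff using L'(1,2) by (rule conjI)
  then have "finite_abelian_p_group p (Zn m Mod L)"
    unfolding finite_abelian_p_group_def order_def ord
    using abelian_FactGroup card_gt_0_iff[of "carrier (Zn m Mod L)"] ord p by auto
  from ex1_iso_reps[OF this] obtain G where
    G: "G \<in> iso_reps p" "Zn m Mod L \<cong> G" and
    uniq: "\<And>H. H \<in> iso_reps p \<Longrightarrow> Zn m Mod L \<cong> H \<Longrightarrow> H = G" by metis
  have "card (carrier G) = p ^ k" using iso_same_card[OF G(2)] ord by simp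
  then have "G \<in> p_reps p k \<and> Zn m Mod L \<cong> G" using G by (simp add: p_reps_def)
  moreover have "H = G" if "H \<in> p_reps p k \<and> Zn m Mod L \<cong> H" for H
    using that uniq by (simp add: p_reps_def)
  ultimately show ?thesis by (rule ex1I)
qed

definition quotient_kernels :: "nat \<Rightarrow> nat \<Rightarrow> nat \<Rightarrow> nat monoid \<Rightarrow> (nat \<Rightarrow>\<^sub>0 int) set set" where
  "quotient_kernels p k m G = {L \<in> index_subgroups (std_lattice m) (p ^ k). Zn m Mod L \<cong> G}"

lemma finite_index_subgroups_lattice:
  "n > 0 \<Longrightarrow> finite (index_subgroups (std_lattice m) n)"
  using card_index_subgroups[OF add_subgroup_lattice order_refl] finite_index_self[OF add_subgroup_lattice] by blast

lemma kernel_in_index_subgroups: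
  assumes "group G" "f \<in> Sur (Zn m) G" "card (carrier G) = n"
  shows "kernel (Zn m) G f \<in> index_subgroups (std_lattice m) n"
  using kernel_Zn[OF assms(1,2)] assms(3) unfolding index_subgroups_def by simp

lemma card_Sur_Zn_rep:
  assumes p: "p > 0" and G: "G \<in> p_reps p k"
  shows "card (Sur (Zn m) G) = card (quotient_kernels p k m G) * card (auto G)"
proof -
  note G' = p_reps_group[OF G]
  let ?I = "index_subgroups (std_lattice m) (p ^ k)"
  let ?S = "\<lambda>L. {f \<in> Sur (Zn m) G. kernel (Zn m) G f = L}"
  have fin: "finite ?I" using p finite_index_subgroups_lattice by simp
  have finS: "finite (Sur (Zn m) G)" by (rule finite_Sur_Zn[OF G'(2,4)])
  have "card (Sur (Zn m) G) = card (\<Union>L\<in>?I. ?S L)"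
    using kernel_in_index_subgroups[OF G'(3) _ G'(5)] by (intro arg_cong[where f = card]) blast
  also have "\<dots> = (\<Sum>L\<in>?I. card (?S L))"
    by (rule card_UN_disjoint[OF fin]) (use finS in auto)
  also have "\<dots> = (\<Sum>L\<in>?I. if Zn m Mod L \<cong> G then card (auto G) else 0)"
  proof (rule sum.cong[OF refl])
    fix L assume "L \<in> ?I"
    then have "add_subgroup L" "L \<subseteq> std_lattice m" by (simp_all add: index_subgroups_def)
    then show "card (?S L) = (if Zn m Mod L \<cong> G then card (auto G) else 0)"
      by (intro card_Sur_kernel group_free_Abelian_group G' normal_Zn)
  qed
  also have "\<dots> = card (quotient_kernels p k m G) * card (auto G)"
    using sum.inter_filter[OF fin, of "\<lambda>_. card (auto G)" "\<lambda>L. Zn m Mod L \<cong> G"]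
    by (simp add: quotient_kernels_def)
  finally show ?thesis .
qed

text \<open>A group of order \<open>p\<^sup>k\<close> is generated by its \<open>p\<^sup>k\<close> elements. Hence it is a quotient of the
lattice of that rank, which has only finitely many sublattices of index \<open>p\<^sup>k\<close>.\<close>

lemma finite_p_reps:
  assumes p: "p > 0"
  shows "finite (p_reps p k)"
proof -
  let ?m = "p ^ k"
  let ?I = "index_subgroups (std_lattice ?m) (p ^ k)"
  have "\<exists>L. L \<in> ?I \<and> Zn ?m Mod L \<cong> G" if G: "G \<in> p_reps p k" for G
  proof -
    note G' = p_reps_group[OF G]
    interpret comm_group G by (rule G'(2))
    obtain g where g: "g ` {..<?m} = carrier G"
      using G'(4,5) by (metis bij_betw_imp_surj_on ex_bij_betw_nat_finite lessThan_atLeast0)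
    then obtain h where h: "h \<in> hom (Zn ?m) G" "\<And>i. i \<in> {..<?m} \<Longrightarrow> h (frag_of i) = g i"
      using free_Abelian_group_universal[of g "{..<?m}"] by (metis order_refl)
    let ?h = "restrict h (carrier (Zn ?m))"
    have hom: "?h \<in> hom (Zn ?m) G"
      by (rule restrict_in_hom[OF group_free_Abelian_group h(1)])
    have "carrier G \<subseteq> ?h ` carrier (Zn ?m)"
    proof
      fix x assume "x \<in> carrier G"
      then obtain i where i: "i < ?m" "x = g i" using g by blast
      then have "frag_of i \<in> carrier (Zn ?m)" by simp
      then have "?h (frag_of i) = x" using h(2)[of i] i by simp
      then show "x \<in> ?h ` carrier (Zn ?m)" using \<open>frag_of i \<in> carrier (Zn ?m)\<close> by blast
    qed
    moreover have "?h ` carrier (Zn ?m) \<subseteq> carrier G" using hom_carrier[OF hom] .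
    ultimately have S: "?h \<in> Sur (Zn ?m) G" unfolding Sur_iff using hom by blast
    interpret f: group_hom "Zn ?m" G ?h
      by (rule Sur_group_hom[OF S group_free_Abelian_group G'(3)])
    show ?thesis
      using kernel_in_index_subgroups[OF G'(3) S G'(5)] f.FactGroup_iso[OF Sur_image[OF S]] by blast
  qed
  then obtain K where K: "\<And>G. G \<in> p_reps p k \<Longrightarrow> K G \<in> ?I \<and> Zn ?m Mod K G \<cong> G" by metis
  have "inj_on K (p_reps p k)"
  proof (rule inj_onI)
    fix G H assume GH: "G \<in> p_reps p k" "H \<in> p_reps p k" "K G = K H"
    have "Zn ?m Mod K G \<cong> G" "Zn ?m Mod K G \<cong> H" using K[OF GH(1)] K[OF GH(2)] GH(3) by simp_all
    then show "G = H" using ex1_quotient_rep[OF p conjunct1[OF K[OF GH(1)]]] GH(1,2)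
      by (metis (no_types))
  qed
  moreover have "K ` p_reps p k \<subseteq> ?I" using K by (intro image_subsetI) simp
  moreover have "finite ?I" using p finite_index_subgroups_lattice by simp
  ultimately show ?thesis using inj_on_finite by metis
qed

text \<open>Count the pairs of a surjection \<open>f\<close> from \<open>\<int>\<^sup>m\<close> to \<open>F\<close> and a subgroup \<open>L\<close> of index
\<open>p\<^sup>n\<^sup>+\<^sup>r\<close> inside the kernel of \<open>f\<close>. For fixed \<open>L\<close> with quotient \<open>G\<close> the possible \<open>f\<close> are the
surjections from \<open>G\<close> to \<open>F\<close>; for fixed \<open>f\<close> the possible \<open>L\<close> are the subgroups of index
\<open>p\<^sup>n\<close> in \<open>ker f\<close>, whose number does not depend on \<open>f\<close>.\<close>

lemma sum_Sur_quotient_kernels: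
  assumes p: "p > 0" and F: "comm_group F" "finite (carrier F)" "card (carrier F) = p ^ r"
  shows "(\<Sum>G\<in>p_reps p (n + r). card (Sur G F) * card (quotient_kernels p (n + r) m G)) =
    card (Sur (Zn m) F) * sublattice_count m (p ^ n)"
proof -
  let ?I = "index_subgroups (std_lattice m) (p ^ (n + r))"
  let ?R = "p_reps p (n + r)"
  let ?Q = "quotient_kernels p (n + r) m"
  let ?S = "Sur (Zn m) F"
  let ?ker = "\<lambda>f. kernel (Zn m) F f"
  have gF: "group F" using F(1) by (rule comm_group.axioms(2))
  have finI: "finite ?I" using p finite_index_subgroups_lattice by simp
  have finS: "finite ?S" by (rule finite_Sur_Zn[OF F(1,2)])
  have Sur_eq: "card (Sur G F) = card {f \<in> ?S. L \<subseteq> ?ker f}"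
    if G: "G \<in> ?R" and L: "L \<in> ?Q G" for G L
  proof -
    note G' = p_reps_group[OF G]
    have "add_subgroup L" "L \<subseteq> std_lattice m" and iso: "Zn m Mod L \<cong> G"
      using L by (simp_all add: quotient_kernels_def index_subgroups_def)
    then have "L \<lhd> Zn m" by (intro normal_Zn)
    then obtain q where q: "q \<in> Sur (Zn m) G" "kernel (Zn m) G q = L"
      using ex_Sur_kernel_iff[OF group_free_Abelian_group G'(3)] iso by blast
    show ?thesis
      using bij_betw_same_card[OF bij_betw_Sur_compose[OF group_free_Abelian_group G'(3) gF q(1)]] q(2)
      by simp
  qed
  have Q_iff: "L \<in> ?Q G \<longleftrightarrow> L \<in> ?I \<and> Zn m Mod L \<cong> G" for L G
    by (simp add: quotient_kernels_def)
  have part: "?I = (\<Union>G\<in>?R. ?Q G)"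
  proof
    show "?I \<subseteq> (\<Union>G\<in>?R. ?Q G)"
    proof
      fix L assume L: "L \<in> ?I"
      then obtain G where "G \<in> ?R" "Zn m Mod L \<cong> G" using ex1_quotient_rep[OF p L] by (elim ex1E conjE)
      then show "L \<in> (\<Union>G\<in>?R. ?Q G)" using L Q_iff by (intro UN_I) simp_all
    qed
    show "(\<Union>G\<in>?R. ?Q G) \<subseteq> ?I" by (rule UN_least, rule subsetI) (simp add: Q_iff)
  qed
  have disj: "?Q G \<inter> ?Q H = {}" if GH: "G \<in> ?R" "H \<in> ?R" "G \<noteq> H" for G H
  proof (rule equals0I)
    fix L assume "L \<in> ?Q G \<inter> ?Q H"
    then have L: "L \<in> ?I" "Zn m Mod L \<cong> G" "Zn m Mod L \<cong> H" by (simp_all add: Q_iff)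
    show False using ex1_quotient_rep[OF p L(1)] GH L(2,3) by (metis (no_types))
  qed
  have finQ: "finite (?Q G)" for G using finI by (simp add: quotient_kernels_def)
  have "(\<Sum>G\<in>?R. card (Sur G F) * card (?Q G)) = (\<Sum>G\<in>?R. \<Sum>L\<in>?Q G. card {f \<in> ?S. L \<subseteq> ?ker f})"
  proof (rule sum.cong[OF refl])
    fix G assume G: "G \<in> ?R"
    have "(\<Sum>L\<in>?Q G. card {f \<in> ?S. L \<subseteq> ?ker f}) = (\<Sum>L\<in>?Q G. card (Sur G F))"
      by (rule sum.cong[OF refl]) (rule Sur_eq[OF G, symmetric])
    then show "card (Sur G F) * card (?Q G) = (\<Sum>L\<in>?Q G. card {f \<in> ?S. L \<subseteq> ?ker f})"
      by simp
  qed
  also have "\<dots> = (\<Sum>L\<in>?I. card {f \<in> ?S. L \<subseteq> ?ker f})"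
    unfolding part by (rule sum.UNION_disjoint[symmetric])
      (use finite_p_reps[OF p] finQ disj in auto)
  also have "\<dots> = (\<Sum>L\<in>?I. \<Sum>f\<in>?S. if L \<subseteq> ?ker f then 1 else 0)"
    using finS by (simp add: sum.If_cases Int_def)
  also have "\<dots> = (\<Sum>f\<in>?S. \<Sum>L\<in>?I. if L \<subseteq> ?ker f then 1 else 0)"
    by (rule sum.swap)
  also have "\<dots> = (\<Sum>f\<in>?S. card {L \<in> ?I. L \<subseteq> ?ker f})"
    using finI by (simp add: sum.If_cases Int_def)
  also have "\<dots> = (\<Sum>f\<in>?S. sublattice_count m (p ^ n))"
  proof (rule sum.cong[OF refl])
    fix f assume f: "f \<in> ?S"
    note K = kernel_Zn[OF gF f]
    have "{L \<in> ?I. L \<subseteq> ?ker f} = index_subgroups (?ker f) (p ^ n)"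
    proof -
      have "index (std_lattice m) L = p ^ (n + r) \<longleftrightarrow> index (?ker f) L = p ^ n"
        if "add_subgroup L" "L \<subseteq> ?ker f" for L
        using index_mult(1)[OF that(1) K(1) that(2) K(2) add_subgroup_lattice] K(3) F(3) p
        by (simp add: power_add)
      then show ?thesis unfolding index_subgroups_def using K(2) by blast
    qed
    then show "card {L \<in> ?I. L \<subseteq> ?ker f} = sublattice_count m (p ^ n)"
      using card_index_subgroups[OF K(1,2) K(4)[OF F(2)], of "p ^ n"] p by simp
  qed
  finally show ?thesis by simp
qed

text \<open>In the limit both auxiliary counts, of surjections from \<open>\<int>\<^sup>m\<close> to \<open>G\<close> and to \<open>F\<close>, have
density 1 among all homomorphisms. As the left side does not involve \<open>F\<close>, the weighted sum is
the same for all \<open>F\<close>.\<close>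

lemma sublattice_series_tendsto:
  assumes p: "p > 0" and F: "comm_group F" "finite (carrier F)" "card (carrier F) = p ^ r"
  shows "(\<lambda>m. sublattice_series p m n) \<longlonglongrightarrow>
    (\<Sum>G\<in>p_reps p (n + r). real (card (Sur G F)) / real (card (auto G)))"
proof -
  let ?R = "p_reps p (n + r)"
  let ?w = "\<lambda>G m. real (card (Sur (Zn m) G)) / real (card (carrier G)) ^ m"
  let ?wF = "\<lambda>m. real (card (Sur (Zn m) F)) / real (card (carrier F)) ^ m"
  let ?s = "\<lambda>G. real (card (Sur G F)) / real (card (auto G))"
  have eq: "(\<Sum>G\<in>?R. ?s G * ?w G m) = ?wF m * sublattice_series p m n" for m
  proof -
    have "?s G * ?w G m = real (card (Sur G F) * card (quotient_kernels p (n + r) m G)) / real p ^ ((n + r) * m)"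
      if G: "G \<in> ?R" for G
      using card_auto_pos[OF p_reps_group(3,4)[OF G]] p_reps_group(5)[OF G] card_Sur_Zn_rep[OF p G]
      by (simp add: power_mult)
    then have "(\<Sum>G\<in>?R. ?s G * ?w G m) =
        (\<Sum>G\<in>?R. real (card (Sur G F) * card (quotient_kernels p (n + r) m G)) / real p ^ ((n + r) * m))"
      by (rule sum.cong[OF refl])
    also have "\<dots> = real (\<Sum>G\<in>?R. card (Sur G F) * card (quotient_kernels p (n + r) m G)) / real p ^ ((n + r) * m)"
      by (simp add: sum_divide_distrib)
    also have "\<dots> = ?wF m * sublattice_series p m n"
      unfolding sum_Sur_quotient_kernels[OF p F]
      by (simp add: sublattice_series_def F(3) power_mult power_add power_mult_distrib)
    finally show ?thesis .
  qed
  have wF: "?wF \<longlonglongrightarrow> 1" by (rule Sur_Zn_density[OF F(1,2)])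
  have "(\<lambda>m. \<Sum>G\<in>?R. ?s G * ?w G m) \<longlonglongrightarrow> (\<Sum>G\<in>?R. ?s G * 1)"
    using p_reps_group by (intro tendsto_sum tendsto_mult tendsto_const Sur_Zn_density) blast+
  then have "(\<lambda>m. (\<Sum>G\<in>?R. ?s G * ?w G m) / ?wF m) \<longlonglongrightarrow> (\<Sum>G\<in>?R. ?s G * 1) / 1"
    by (rule tendsto_divide[OF _ wF]) simp
  moreover have "\<forall>\<^sub>F m in sequentially. (\<Sum>G\<in>?R. ?s G * ?w G m) / ?wF m = sublattice_series p m n"
  proof (rule eventually_mono)
    show "\<forall>\<^sub>F m in sequentially. ?wF m \<noteq> 0"
      by (rule tendsto_imp_eventually_ne[OF wF]) simp
    fix m assume "?wF m \<noteq> 0"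
    then show "(\<Sum>G\<in>?R. ?s G * ?w G m) / ?wF m = sublattice_series p m n"
      unfolding eq by (rule nonzero_mult_div_cancel_left)
  qed
  ultimately have "(\<lambda>m. sublattice_series p m n) \<longlonglongrightarrow> (\<Sum>G\<in>?R. ?s G * 1) / 1"
    by (rule Lim_transform_eventually)
  then show ?thesis by simp
qed

lemma card_Sur_eq_0:
  assumes "finite (carrier G)" "card (carrier G) < card (carrier F)"
  shows "card (Sur G F) = 0"
proof -
  have "Sur G F = {}"
    using card_image_le[OF assms(1)] assms(2) Sur_image by (metis equals0I leD)
  then show ?thesis by simp
qed

text \<open>The moments of the Cohen-Lenstra distribution. Groups of order less than that of \<open>F\<close> admit
no surjection onto \<open>F\<close>, which accounts for the shift by \<open>r\<close> in the series.\<close>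

theorem has_sum_Sur_moment:
  assumes p: "Factorial_Ring.prime p" and F: "finite_abelian_p_group p F"
  shows "((\<lambda>G. real (card (Sur G F)) / real (card (auto G))) has_sum (1 / c0 p)) (iso_reps p)"
proof -
  let ?s = "\<lambda>G. real (card (Sur G F)) / real (card (auto G))"
  obtain r where F': "comm_group F" "finite (carrier F)" "card (carrier F) = p ^ r"
    using F by (auto simp: finite_abelian_p_group_def order_def)
  have p1: "p > 1" and p0: "p > 0" using prime_gt_1_nat[OF p] by auto
  let ?g = "\<lambda>k. \<Sum>G\<in>p_reps p k. ?s G"
  have "(\<lambda>n. ?g (n + r)) sums (1 / c0 p)"
    by (rule sublattice_series_limit_sums[OF p]) (rule sublattice_series_tendsto[OF p0 F'])
  moreover have zero: "?g k = 0" if "k < r" for k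
  proof (rule sum.neutral, rule ballI)
    fix G assume "G \<in> p_reps p k"
    note G = p_reps_group[OF this]
    have "card (carrier G) < card (carrier F)" using G(5) F'(3) p1 that by simp
    then have "card (Sur G F) = 0" by (rule card_Sur_eq_0[OF G(4)])
    then show "?s G = 0" by simp
  qed
  ultimately have "?g sums (1 / c0 p)"
    using sums_iff_shift[of ?g r "1 / c0 p"] by simp
  then have g: "(?g has_sum (1 / c0 p)) UNIV"
    by (rule sums_nonneg_imp_has_sum) (simp add: sum_nonneg)
  let ?D = "SIGMA k:UNIV. p_reps p k"
  have inner: "((\<lambda>G. ?s (snd (k, G))) has_sum ?g k) (p_reps p k)" for k
    using has_sum_finite[OF finite_p_reps[OF p0], of ?s k] by simp
  have "((\<lambda>x. ?s (snd x)) has_sum (1 / c0 p)) ?D"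
  proof (rule has_sum_SigmaI[OF inner g])
    show "(\<lambda>x. ?s (snd x)) summable_on ?D"
      by (rule summable_on_SigmaI[OF inner]) (use g in \<open>auto simp: summable_on_def\<close>)
  qed
  moreover have "bij_betw snd ?D (iso_reps p)"
    unfolding bij_betw_def
  proof
    show "inj_on snd ?D" using p1 by (auto simp: inj_on_def p_reps_def)
    have "\<exists>k. G \<in> p_reps p k" if "G \<in> iso_reps p" for G
      using that iso_reps_subset[of p]
      by (auto simp: p_reps_def nat_p_groups_def finite_abelian_p_group_def order_def)
    then show "snd ` ?D = iso_reps p" by (force simp: p_reps_def)
  qed
  ultimately show ?thesis using has_sum_reindex_bij_betw[of snd ?D "iso_reps p" ?s] by simp
qed

section \<open>Subdirect products and Goursat's lemma\<close>

abbreviation subproduct :: "('a, 'c) monoid_scheme \<Rightarrow> ('b, 'd) monoid_scheme \<Rightarrow> ('a \<times> 'b) set \<Rightarrow> ('a \<times> 'b) monoid" where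
  "subproduct F1 F2 H \<equiv> (F1 \<times>\<times> F2)\<lparr>carrier := H\<rparr>"

definition subdirect :: "('a, 'c) monoid_scheme \<Rightarrow> ('b, 'd) monoid_scheme \<Rightarrow> ('a \<times> 'b) set set" where
  "subdirect F1 F2 = {H. subgroup H (F1 \<times>\<times> F2) \<and> fst ` H = carrier F1 \<and> snd ` H = carrier F2}"

lemma subdirect_subset:
  assumes "H \<in> subdirect F1 F2"
  shows "H \<subseteq> carrier F1 \<times> carrier F2"
  using assms subgroup.subset[of H "F1 \<times>\<times> F2"] by (simp add: subdirect_def)

lemma subdirect_group:
  assumes "group F1" "group F2" "H \<in> subdirect F1 F2"
  shows "group (subproduct F1 F2 H)"
  using assms subgroup.subgroup_is_group[OF _ DirProd_group[OF assms(1,2)]]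
  by (simp add: subdirect_def)

lemma subdirect_proj_Sur:
  assumes "H \<in> subdirect F1 F2"
  shows "restrict fst H \<in> Sur (subproduct F1 F2 H) F1" "restrict snd H \<in> Sur (subproduct F1 F2 H) F2"
proof -
  have H: "fst ` H = carrier F1" "snd ` H = carrier F2" and sub: "subgroup H (F1 \<times>\<times> F2)"
    using assms by (auto simp: subdirect_def)
  have cl: "x \<otimes>\<^bsub>F1 \<times>\<times> F2\<^esub> y \<in> H" if "x \<in> H" "y \<in> H" for x y
    using subgroup.m_closed[OF sub that] .
  have "restrict fst H \<in> hom (subproduct F1 F2 H) F1" "restrict snd H \<in> hom (subproduct F1 F2 H) F2"
    by (rule homI, use H cl in \<open>auto simp: mult_DirProd'\<close>)+
  then show "restrict fst H \<in> Sur (subproduct F1 F2 H) F1" "restrict snd H \<in> Sur (subproduct F1 F2 H) F2"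
    using H by (simp_all add: Sur_iff)
qed

lemma finite_Sur:
  assumes "finite (carrier G)" "finite (carrier H)"
  shows "finite (Sur G H)"
proof (rule finite_subset)
  show "Sur G H \<subseteq> carrier G \<rightarrow>\<^sub>E carrier H" by (auto simp: Sur_iff PiE_def hom_def)
  show "finite (carrier G \<rightarrow>\<^sub>E carrier H)" using assms by (intro finite_PiE)
qed

lemma finite_subdirect:
  assumes "finite (carrier F1)" "finite (carrier F2)"
  shows "finite (subdirect F1 F2)"
proof (rule finite_subset)
  show "subdirect F1 F2 \<subseteq> Pow (carrier F1 \<times> carrier F2)"
    using subdirect_subset by blast
  show "finite (Pow (carrier F1 \<times> carrier F2))" using assms by simp
qed

text \<open>A pair of surjections is one homomorphism to the product, sorted here by its image.\<close>

lemma card_Sur_pairs: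
  assumes G: "group G" and F1: "group F1" and F2: "group F2"
    and fin: "finite (carrier G)" "finite (carrier F1)" "finite (carrier F2)"
  shows "card (Sur G F1) * card (Sur G F2) = (\<Sum>H\<in>subdirect F1 F2. card (Sur G (subproduct F1 F2 H)))"
proof -
  let ?pair = "\<lambda>(f1, f2). \<lambda>x\<in>carrier G. (f1 x, f2 x)"
  let ?U = "\<Union>H\<in>subdirect F1 F2. Sur G (subproduct F1 F2 H)"
  have inj: "inj_on ?pair (Sur G F1 \<times> Sur G F2)"
  proof (rule inj_onI, clarify)
    fix f1 f2 g1 g2
    assume *: "f1 \<in> Sur G F1" "f2 \<in> Sur G F2" "g1 \<in> Sur G F1" "g2 \<in> Sur G F2"
      and eq: "(\<lambda>x\<in>carrier G. (f1 x, f2 x)) = (\<lambda>x\<in>carrier G. (g1 x, g2 x))"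
    have "f1 x = g1 x \<and> f2 x = g2 x" if "x \<in> carrier G" for x
      using fun_cong[OF eq, of x] that by simp
    then show "f1 = g1 \<and> f2 = g2"
      using * by (auto simp: Sur_iff intro: extensionalityI)
  qed
  have "?pair ` (Sur G F1 \<times> Sur G F2) = ?U"
  proof
    show "?pair ` (Sur G F1 \<times> Sur G F2) \<subseteq> ?U"
    proof clarify
      fix f1 f2 assume f: "f1 \<in> Sur G F1" "f2 \<in> Sur G F2"
      let ?f = "\<lambda>x\<in>carrier G. (f1 x, f2 x)"
      let ?H = "?f ` carrier G"
      have hom: "?f \<in> hom G (F1 \<times>\<times> F2)"
        using f restrict_in_hom[OF G] hom_paired[of f1 f2 G F1 F2] by (simp add: Sur_iff)
      then interpret f: group_hom G "F1 \<times>\<times> F2" ?f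
        using G DirProd_group[OF F1 F2] by (simp add: group_hom_def group_hom_axioms_def)
      have "fst ` ?H = f1 ` carrier G" "snd ` ?H = f2 ` carrier G"
        by (auto simp: image_image)
      then have H: "?H \<in> subdirect F1 F2"
        using f.img_is_subgroup f by (simp add: subdirect_def Sur_iff)
      have "?f \<in> hom G (subproduct F1 F2 ?H)"
        using hom by (auto simp: hom_def)
      then have "?f \<in> Sur G (subproduct F1 F2 ?H)" by (simp add: Sur_iff)
      with H show "?f \<in> ?U" by blast
    qed
    show "?U \<subseteq> ?pair ` (Sur G F1 \<times> Sur G F2)"
    proof clarify
      fix H f assume H: "H \<in> subdirect F1 F2" and f: "f \<in> Sur G (subproduct F1 F2 H)"
      have fH: "f x \<in> H" if "x \<in> carrier G" for x
        using Sur_image[OF f] that by auto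
      have "f = ?pair (compose (carrier G) (restrict fst H) f, compose (carrier G) (restrict snd H) f)"
      proof (rule extensionalityI)
        show "f \<in> extensional (carrier G)" using f by (simp add: Sur_iff)
      qed (use fH in \<open>auto simp: compose_def\<close>)
      moreover have "compose (carrier G) (restrict fst H) f \<in> Sur G F1"
        using bij_betwE[OF bij_betw_Sur_compose[OF G subdirect_group[OF F1 F2 H] F1 f]]
          subdirect_proj_Sur(1)[OF H] by blast
      moreover have "compose (carrier G) (restrict snd H) f \<in> Sur G F2"
        using bij_betwE[OF bij_betw_Sur_compose[OF G subdirect_group[OF F1 F2 H] F2 f]]
          subdirect_proj_Sur(2)[OF H] by blast
      ultimately show "f \<in> ?pair ` (Sur G F1 \<times> Sur G F2)" 
        by (intro rev_image_eqI[of "(compose (carrier G) (restrict fst H) f, compose (carrier G) (restrict snd H) f)"])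
          simp_all
    qed
  qed
  then have "card (Sur G F1) * card (Sur G F2) = card ?U"
    using card_image[OF inj] by (simp add: card_cartesian_product)
  also have "\<dots> = (\<Sum>H\<in>subdirect F1 F2. card (Sur G (subproduct F1 F2 H)))"
  proof (rule card_UN_disjoint)
    show "finite (subdirect F1 F2)" by (rule finite_subdirect[OF fin(2,3)])
    show "\<forall>H\<in>subdirect F1 F2. finite (Sur G (subproduct F1 F2 H))"
    proof
      fix H assume "H \<in> subdirect F1 F2"
      then have "finite H"
        by (rule finite_subset[OF subdirect_subset finite_cartesian_product[OF fin(2,3)]])
      then show "finite (Sur G (subproduct F1 F2 H))" using fin(1) by (intro finite_Sur) simp_all
    qed
    have "f \<notin> Sur G (subproduct F1 F2 K)" if "f \<in> Sur G (subproduct F1 F2 H)" "H \<noteq> K" for f H K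
      using that by (simp add: Sur_iff)
    then show "\<forall>H\<in>subdirect F1 F2. \<forall>K\<in>subdirect F1 F2. H \<noteq> K \<longrightarrow>
        Sur G (subproduct F1 F2 H) \<inter> Sur G (subproduct F1 F2 K) = {}" by blast
  qed
  finally show ?thesis .
qed

text \<open>The kernel of the second projection of \<open>H\<close>, seen in the first factor: the quotient of the
first factor by it is the common quotient in Goursat's lemma.\<close>

definition left_kernel :: "('a, 'c) monoid_scheme \<Rightarrow> ('b, 'd) monoid_scheme \<Rightarrow> ('a \<times> 'b) set \<Rightarrow> 'a set" where
  "left_kernel F1 F2 H = {a. (a, \<one>\<^bsub>F2\<^esub>) \<in> H}"

definition fibre_product ::
    "('a, 'c) monoid_scheme \<Rightarrow> ('b, 'd) monoid_scheme \<Rightarrow> ('a \<Rightarrow> 'g) \<Rightarrow> ('b \<Rightarrow> 'g) \<Rightarrow> ('a \<times> 'b) set" where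
  "fibre_product F1 F2 \<alpha> \<beta> = {(a, b) \<in> carrier F1 \<times> carrier F2. \<alpha> a = \<beta> b}"

lemma fibre_product_subdirect:
  assumes F1: "group F1" and F2: "group F2" and G: "group G"
    and \<alpha>: "\<alpha> \<in> Sur F1 G" and \<beta>: "\<beta> \<in> Sur F2 G"
  shows "fibre_product F1 F2 \<alpha> \<beta> \<in> subdirect F1 F2"
proof -
  interpret a: group_hom F1 G \<alpha> by (rule Sur_group_hom[OF \<alpha> F1 G])
  interpret b: group_hom F2 G \<beta> by (rule Sur_group_hom[OF \<beta> F2 G])
  interpret P: group "F1 \<times>\<times> F2" by (rule DirProd_group[OF F1 F2])
  have "subgroup (fibre_product F1 F2 \<alpha> \<beta>) (F1 \<times>\<times> F2)"
  proof (rule P.subgroupI)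
    show "fibre_product F1 F2 \<alpha> \<beta> \<subseteq> carrier (F1 \<times>\<times> F2)" by (auto simp: fibre_product_def)
    have "(\<one>\<^bsub>F1\<^esub>, \<one>\<^bsub>F2\<^esub>) \<in> fibre_product F1 F2 \<alpha> \<beta>"
      by (simp add: fibre_product_def)
    then show "fibre_product F1 F2 \<alpha> \<beta> \<noteq> {}" by blast
  qed (auto simp: fibre_product_def inv_DirProd[OF F1 F2])
  moreover have "a \<in> fst ` fibre_product F1 F2 \<alpha> \<beta>" if a: "a \<in> carrier F1" for a
  proof -
    have "\<alpha> a \<in> \<beta> ` carrier F2" using a Sur_image[OF \<beta>] by simp
    then obtain b where "b \<in> carrier F2" "\<alpha> a = \<beta> b" by blast
    then show ?thesis using a by (force simp: fibre_product_def)
  qed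
  moreover have "b \<in> snd ` fibre_product F1 F2 \<alpha> \<beta>" if b: "b \<in> carrier F2" for b
  proof -
    have "\<beta> b \<in> \<alpha> ` carrier F1" using b Sur_image[OF \<alpha>] by simp
    then obtain a where "a \<in> carrier F1" "\<alpha> a = \<beta> b" by force
    then show ?thesis using b by (force simp: fibre_product_def)
  qed
  ultimately show ?thesis by (auto simp: subdirect_def) (auto simp: fibre_product_def)
qed

text \<open>For a given subdirect product \<open>H\<close> the surjection \<open>\<alpha>\<close> determines \<open>\<beta>\<close>: composed with the
first projection, \<open>\<alpha>\<close> vanishes on the kernel of the second projection \<open>H \<rightarrow> F2\<close>, so it factors
uniquely through that projection.\<close>

lemma card_Sur_fibre_product:
  assumes F1: "group F1" and F2: "group F2" and G: "group G" and H: "H \<in> subdirect F1 F2"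
  shows "card {(\<alpha>, \<beta>) \<in> Sur F1 G \<times> Sur F2 G. fibre_product F1 F2 \<alpha> \<beta> = H}
    = card {\<alpha> \<in> Sur F1 G. kernel F1 G \<alpha> = left_kernel F1 F2 H}" (is "card ?P = card ?K")
proof -
  have subH: "subgroup H (F1 \<times>\<times> F2)" and sndH: "snd ` H = carrier F2"
    using H by (auto simp: subdirect_def)
  have HF: "a \<in> carrier F1 \<and> b \<in> carrier F2" if "(a, b) \<in> H" for a b
    using subdirect_subset[OF H] that by blast
  have exa: "\<exists>a. (a, b) \<in> H" if "b \<in> carrier F2" for b using that sndH by force
  have "bij_betw fst ?P ?K"
    unfolding bij_betw_def
  proof
    show "inj_on fst ?P"
    proof (rule inj_onI, clarsimp)
      fix \<alpha> \<beta> \<beta>' assume *: "\<beta> \<in> Sur F2 G" "\<beta>' \<in> Sur F2 G"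
        "fibre_product F1 F2 \<alpha> \<beta>' = fibre_product F1 F2 \<alpha> \<beta>" "H = fibre_product F1 F2 \<alpha> \<beta>"
      show "\<beta> = \<beta>'"
      proof (rule extensionalityI)
        fix b assume "b \<in> carrier F2"
        then obtain a where "(a, b) \<in> H" using exa by blast
        then have "(a, b) \<in> fibre_product F1 F2 \<alpha> \<beta>" "(a, b) \<in> fibre_product F1 F2 \<alpha> \<beta>'"
          using *(3,4) by simp_all
        then show "\<beta> b = \<beta>' b" by (simp add: fibre_product_def)
      qed (use * in \<open>auto simp: Sur_iff\<close>)
    qed
    show "fst ` ?P = ?K"
    proof
      show "fst ` ?P \<subseteq> ?K"
      proof clarify
        fix \<alpha> \<beta> assume \<alpha>: "\<alpha> \<in> Sur F1 G" and \<beta>: "\<beta> \<in> Sur F2 G"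
        interpret b: group_hom F2 G \<beta> by (rule Sur_group_hom[OF \<beta> F2 G])
        show "fst (\<alpha>, \<beta>) \<in> Sur F1 G \<and>
            kernel F1 G (fst (\<alpha>, \<beta>)) = left_kernel F1 F2 (fibre_product F1 F2 \<alpha> \<beta>)"
          using \<alpha> by (simp add: kernel_def left_kernel_def fibre_product_def)
      qed
      show "?K \<subseteq> fst ` ?P"
      proof clarify
        fix \<alpha> assume \<alpha>: "\<alpha> \<in> Sur F1 G" and ker: "kernel F1 G \<alpha> = left_kernel F1 F2 H"
        interpret a: group_hom F1 G \<alpha> by (rule Sur_group_hom[OF \<alpha> F1 G])
        note gH = subdirect_group[OF F1 F2 H]
        note \<pi> = subdirect_proj_Sur[OF H]
        let ?f = "compose H \<alpha> (restrict fst H)"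
        have fS: "?f \<in> Sur (subproduct F1 F2 H) G"
          using bij_betwE[OF bij_betw_Sur_compose[OF gH F1 G \<pi>(1)]] \<alpha> by simp
        have "kernel (subproduct F1 F2 H) F2 (restrict snd H) \<subseteq> kernel (subproduct F1 F2 H) G ?f"
        proof
          fix z assume "z \<in> kernel (subproduct F1 F2 H) F2 (restrict snd H)"
          then have z: "z \<in> H" "snd z = \<one>\<^bsub>F2\<^esub>" by (simp_all add: kernel_def split: if_splits)
          then have "fst z \<in> left_kernel F1 F2 H" by (metis left_kernel_def mem_Collect_eq prod.collapse)
          then have "\<alpha> (fst z) = \<one>\<^bsub>G\<^esub>" using ker by (auto simp: kernel_def)
          then show "z \<in> kernel (subproduct F1 F2 H) G ?f" using z by (simp add: kernel_def compose_def)
        qed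
        then have "?f \<in> (\<lambda>g. compose H g (restrict snd H)) ` Sur F2 G"
          using bij_betw_imp_surj_on[OF bij_betw_Sur_compose[OF gH F2 G \<pi>(2)]] fS by simp
        then obtain \<beta> where \<beta>: "\<beta> \<in> Sur F2 G" and eq: "?f = compose H \<beta> (restrict snd H)" by blast
        have ab: "\<alpha> a = \<beta> b" if "(a, b) \<in> H" for a b
          using fun_cong[OF eq, of "(a, b)"] that by (simp add: compose_def)
        have "fibre_product F1 F2 \<alpha> \<beta> = H"
        proof
          show "H \<subseteq> fibre_product F1 F2 \<alpha> \<beta>" using ab HF by (auto simp: fibre_product_def)
          show "fibre_product F1 F2 \<alpha> \<beta> \<subseteq> H"
          proof clarify
            fix a b assume "(a, b) \<in> fibre_product F1 F2 \<alpha> \<beta>"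
            then have *: "a \<in> carrier F1" "b \<in> carrier F2" "\<alpha> a = \<beta> b"
              by (simp_all add: fibre_product_def)
            obtain a0 where a0: "(a0, b) \<in> H" using exa[OF *(2)] by blast
            have a0F: "a0 \<in> carrier F1" using HF[OF a0] by simp
            have "\<alpha> a = \<alpha> a0" using *(3) ab[OF a0] by simp
            then have "a \<otimes>\<^bsub>F1\<^esub> inv\<^bsub>F1\<^esub> a0 \<in> kernel F1 G \<alpha>"
              using hom_eq_iff_kernel[OF a.group_hom_axioms *(1) a0F] by simp
            then have "(a \<otimes>\<^bsub>F1\<^esub> inv\<^bsub>F1\<^esub> a0, \<one>\<^bsub>F2\<^esub>) \<in> H" using ker by (simp add: left_kernel_def)
            from subgroup.m_closed[OF subH this a0]
            have "(a \<otimes>\<^bsub>F1\<^esub> inv\<^bsub>F1\<^esub> a0 \<otimes>\<^bsub>F1\<^esub> a0, \<one>\<^bsub>F2\<^esub> \<otimes>\<^bsub>F2\<^esub> b) \<in> H" by simp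
            moreover have "a \<otimes>\<^bsub>F1\<^esub> inv\<^bsub>F1\<^esub> a0 \<otimes>\<^bsub>F1\<^esub> a0 = a"
              using *(1) a0F by (simp add: a.G.m_assoc)
            moreover have "\<one>\<^bsub>F2\<^esub> \<otimes>\<^bsub>F2\<^esub> b = b"
              using monoid.l_one[OF group.is_monoid[OF F2] *(2)] .
            ultimately show "(a, b) \<in> H" by simp
          qed
        qed
        then have "(\<alpha>, \<beta>) \<in> ?P" using \<alpha> \<beta> by simp
        then show "\<alpha> \<in> fst ` ?P" by (rule rev_image_eqI) simp
      qed
    qed
  qed
  then show ?thesis by (rule bij_betw_same_card)
qed

lemma left_kernel_normal:
  assumes F1: "comm_group F1" and F2: "group F2" and H: "H \<in> subdirect F1 F2"
  shows "left_kernel F1 F2 H \<lhd> F1"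
proof -
  interpret F1: comm_group F1 by fact
  interpret F2: group F2 by fact
  have sub: "subgroup H (F1 \<times>\<times> F2)" using H by (simp add: subdirect_def)
  have mem: "a \<in> carrier F1" if "(a, \<one>\<^bsub>F2\<^esub>) \<in> H" for a
    using subdirect_subset[OF H] that by blast
  have "subgroup (left_kernel F1 F2 H) F1"
  proof (rule F1.subgroupI)
    show "left_kernel F1 F2 H \<subseteq> carrier F1" using mem by (auto simp: left_kernel_def)
    have "\<one>\<^bsub>F1\<^esub> \<in> left_kernel F1 F2 H" using subgroup.one_closed[OF sub] by (simp add: left_kernel_def)
    then show "left_kernel F1 F2 H \<noteq> {}" by blast
    fix a b assume ab: "a \<in> left_kernel F1 F2 H" "b \<in> left_kernel F1 F2 H"
    then have ab': "(a, \<one>\<^bsub>F2\<^esub>) \<in> H" "(b, \<one>\<^bsub>F2\<^esub>) \<in> H" by (simp_all add: left_kernel_def)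
    show "inv\<^bsub>F1\<^esub> a \<in> left_kernel F1 F2 H"
      using subgroup.m_inv_closed[OF sub ab'(1)] inv_DirProd[OF F1.is_group F2 mem[OF ab'(1)] F2.one_closed]
      by (simp add: left_kernel_def)
    show "a \<otimes>\<^bsub>F1\<^esub> b \<in> left_kernel F1 F2 H"
      using subgroup.m_closed[OF sub ab'] by (simp add: left_kernel_def)
  qed
  then show ?thesis by (simp add: F1.normal_iff_subgroup)
qed

lemma p_group_order_dvd:
  assumes "Factorial_Ring.prime p" "comm_group G" "finite (carrier G)" "order G dvd p ^ n"
  shows "finite_abelian_p_group p G"
  using assms divides_primepow_nat[OF assms(1), of "order G" n]
  by (auto simp: finite_abelian_p_group_def)

lemma p_group_subdirect:
  assumes p: "Factorial_Ring.prime p" and F1: "finite_abelian_p_group p F1"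
    and F2: "finite_abelian_p_group p F2" and H: "H \<in> subdirect F1 F2"
  shows "finite_abelian_p_group p (subproduct F1 F2 H)"
proof -
  obtain r s where F: "comm_group F1" "comm_group F2" "finite (carrier F1)" "finite (carrier F2)"
    "order F1 = p ^ r" "order F2 = p ^ s"
    using F1 F2 by (auto simp: finite_abelian_p_group_def)
  interpret F1: comm_group F1 by fact
  interpret F2: comm_group F2 by fact
  interpret P: group "F1 \<times>\<times> F2" by (rule DirProd_group) unfold_locales
  have sub: "subgroup H (F1 \<times>\<times> F2)" using H by (simp add: subdirect_def)
  have HP: "x \<in> carrier F1 \<times> carrier F2" if "x \<in> H" for x using subdirect_subset[OF H] that by blast
  have "comm_group (subproduct F1 F2 H)"
  proof (rule group.group_comm_groupI)
    show "group (subproduct F1 F2 H)" by (rule subdirect_group[OF F1.is_group F2.is_group H])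
    fix x y assume "x \<in> carrier (subproduct F1 F2 H)" "y \<in> carrier (subproduct F1 F2 H)"
    then show "x \<otimes>\<^bsub>subproduct F1 F2 H\<^esub> y = y \<otimes>\<^bsub>subproduct F1 F2 H\<^esub> x"
      using HP[of x] HP[of y] by (auto simp: F1.m_comm F2.m_comm)
  qed
  moreover have "finite H"
    by (rule finite_subset[OF subdirect_subset[OF H] finite_cartesian_product[OF F(3,4)]])
  moreover have "order (F1 \<times>\<times> F2) = p ^ (r + s)"
    using F(5,6) by (simp add: order_def card_cartesian_product power_add)
  then have "card H dvd p ^ (r + s)"
    using dvd_triv_right[of "card H" "card (rcosets\<^bsub>F1 \<times>\<times> F2\<^esub> H)"] P.lagrange[OF sub] by simp
  then have "order (subproduct F1 F2 H) dvd p ^ (r + s)" by (simp add: order_def)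
  ultimately show ?thesis by (intro p_group_order_dvd[OF p]) simp_all
qed

lemma p_group_quotient:
  assumes p: "Factorial_Ring.prime p" and F: "finite_abelian_p_group p F" and N: "N \<lhd> F"
  shows "finite_abelian_p_group p (F Mod N)" "card (carrier (F Mod N)) \<le> card (carrier F)"
proof -
  obtain r where F': "comm_group F" "finite (carrier F)" "order F = p ^ r"
    using F by (auto simp: finite_abelian_p_group_def)
  interpret F: comm_group F by fact
  have sub: "subgroup N F" by (rule normal_imp_subgroup[OF N])
  have "order (F Mod N) dvd p ^ r"
    using dvd_triv_left[of "card (rcosets\<^bsub>F\<^esub> N)" "card N"] F.lagrange[OF sub] F'(3)
    by (simp add: order_def FactGroup_def)
  moreover have "finite (carrier (F Mod N))" unfolding carrier_FactGroup using F'(2) by simp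
  ultimately show "finite_abelian_p_group p (F Mod N)"
    using p_group_order_dvd[OF p F.abelian_FactGroup[OF sub]] by blast
  show "card (carrier (F Mod N)) \<le> card (carrier F)"
    unfolding carrier_FactGroup using F'(2) by (rule card_image_le)
qed

text \<open>Goursat's lemma as a count. Sort the pairs of surjections by their fibre product \<open>H\<close>: there
are \<open>#Aut(G)\<close> pairs if \<open>G\<close> is isomorphic to the quotient of \<open>F1\<close> by the left kernel of \<open>H\<close>, and
none otherwise, and every \<open>H\<close> has exactly one such \<open>G\<close> among the representatives. Only the
finitely many \<open>G\<close> of order at most that of \<open>F1\<close> contribute.\<close>

theorem has_sum_card_subdirect:
  assumes p: "Factorial_Ring.prime p" and F1: "finite_abelian_p_group p F1"
    and F2: "finite_abelian_p_group p F2"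
  shows "((\<lambda>G. real (card (Sur F1 G)) * real (card (Sur F2 G)) / real (card (auto G)))
           has_sum real (card (subdirect F1 F2))) (iso_reps p)"
proof -
  have F: "comm_group F1" "group F1" "group F2" "finite (carrier F1)" "finite (carrier F2)"
    using F1 F2 by (auto simp: finite_abelian_p_group_def comm_group.axioms(2))
  let ?S = "subdirect F1 F2"
  let ?Q = "\<lambda>H. F1 Mod left_kernel F1 F2 H"
  let ?fp = "fibre_product F1 F2"
  define R where "R = {G \<in> iso_reps p. card (carrier G) \<le> card (carrier F1)}"
  have p0: "p > 0" "p > 1" using prime_gt_1_nat[OF p] by auto
  have finS: "finite ?S" by (rule finite_subdirect[OF F(4,5)])
  have grp: "group G" "finite (carrier G)" "\<exists>k. card (carrier G) = p ^ k" if "G \<in> iso_reps p" for G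
    using that iso_reps_subset[of p]
    by (auto simp: nat_p_groups_def finite_abelian_p_group_def comm_group.axioms(2) order_def)
  have "R \<subseteq> (\<Union>k\<in>{..card (carrier F1)}. p_reps p k)"
  proof
    fix G assume G: "G \<in> R"
    then have "G \<in> iso_reps p" by (simp add: R_def)
    from grp(3)[OF this] obtain k where k: "card (carrier G) = p ^ k" ..
    have "k < p ^ k" using power_gt_expt[of p k] p0(2) by simp
    then have "k \<le> card (carrier F1)" using G k by (simp add: R_def)
    then show "G \<in> (\<Union>k\<in>{..card (carrier F1)}. p_reps p k)" using G k by (auto simp: R_def p_reps_def)
  qed
  then have finR: "finite R" by (rule finite_subset) (use finite_p_reps[OF p0(1)] in simp)
  have unique: "\<exists>!G. G \<in> R \<and> ?Q H \<cong> G" if H: "H \<in> ?S" for H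
  proof -
    note N = left_kernel_normal[OF F(1,3) H]
    obtain G where G: "G \<in> iso_reps p" "?Q H \<cong> G"
      and uniq: "\<And>G'. G' \<in> iso_reps p \<Longrightarrow> ?Q H \<cong> G' \<Longrightarrow> G' = G"
      using ex1_iso_reps[OF p_group_quotient(1)[OF p F1 N]] by metis
    have "card (carrier G) \<le> card (carrier F1)"
      using p_group_quotient(2)[OF p F1 N] iso_same_card[OF G(2)] by simp
    with G have "G \<in> R \<and> ?Q H \<cong> G" by (simp add: R_def)
    moreover have "G' = G" if "G' \<in> R \<and> ?Q H \<cong> G'" for G' using that uniq by (simp add: R_def)
    ultimately show ?thesis by (rule ex1I)
  qed
  have pairs: "card (Sur F1 G) * card (Sur F2 G) = (\<Sum>H\<in>?S. if ?Q H \<cong> G then card (auto G) else 0)"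
    if "G \<in> iso_reps p" for G
  proof -
    note G = grp(1,2)[OF that]
    let ?P = "Sur F1 G \<times> Sur F2 G"
    let ?fib = "\<lambda>H. {(\<alpha>, \<beta>) \<in> ?P. ?fp \<alpha> \<beta> = H}"
    have finP: "finite ?P" using finite_Sur[OF F(4) G(2)] finite_Sur[OF F(5) G(2)] by simp
    have "?P = (\<Union>H\<in>?S. ?fib H)"
    proof
      show "?P \<subseteq> (\<Union>H\<in>?S. ?fib H)"
      proof clarify
        fix \<alpha> \<beta> assume *: "\<alpha> \<in> Sur F1 G" "\<beta> \<in> Sur F2 G"
        have "?fp \<alpha> \<beta> \<in> ?S" by (rule fibre_product_subdirect[OF F(2,3) G(1) *])
        then show "(\<alpha>, \<beta>) \<in> (\<Union>H\<in>?S. ?fib H)" using * by simp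
      qed
    qed blast
    then have "card ?P = card (\<Union>H\<in>?S. ?fib H)" by (rule arg_cong)
    also have "\<dots> = (\<Sum>H\<in>?S. card (?fib H))"
    proof (rule card_UN_disjoint[OF finS])
      have "?fib H \<subseteq> ?P" for H by auto
      then show "\<forall>H\<in>?S. finite (?fib H)" using finP by (intro ballI) (rule finite_subset)
      show "\<forall>H\<in>?S. \<forall>K\<in>?S. H \<noteq> K \<longrightarrow> ?fib H \<inter> ?fib K = {}"
        by (intro ballI impI equals0I) auto
    qed
    also have "\<dots> = (\<Sum>H\<in>?S. if ?Q H \<cong> G then card (auto G) else 0)"
    proof (rule sum.cong[OF refl])
      fix H assume H: "H \<in> ?S"
      show "card (?fib H) = (if ?Q H \<cong> G then card (auto G) else 0)"
        unfolding card_Sur_fibre_product[OF F(2,3) G(1) H]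
        by (rule card_Sur_kernel[OF F(2) G left_kernel_normal[OF F(1,3) H]])
    qed
    finally show ?thesis by (simp add: card_cartesian_product)
  qed
  show ?thesis
  proof (rule has_sum_finite_neutralI[OF finR])
    show "R \<subseteq> iso_reps p" by (auto simp: R_def)
    fix G assume "G \<in> iso_reps p - R"
    then have "card (carrier F1) < card (carrier G)" by (auto simp: R_def)
    then have "card (Sur F1 G) = 0" by (rule card_Sur_eq_0[OF F(4)])
    then show "real (card (Sur F1 G)) * real (card (Sur F2 G)) / real (card (auto G)) = 0" by simp
  next
    have "(\<Sum>G\<in>R. real (card (Sur F1 G)) * real (card (Sur F2 G)) / real (card (auto G))) =
      (\<Sum>G\<in>R. \<Sum>H\<in>?S. if ?Q H \<cong> G then 1 else 0)"
    proof (rule sum.cong[OF refl])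
      fix G assume "G \<in> R"
      then have G: "G \<in> iso_reps p" by (simp add: R_def)
      have "card (auto G) > 0" by (rule card_auto_pos[OF grp(1,2)[OF G]])
      have "real (card (Sur F1 G)) * real (card (Sur F2 G)) / real (card (auto G)) =
          real (\<Sum>H\<in>?S. if ?Q H \<cong> G then card (auto G) else 0) / real (card (auto G))"
        unfolding pairs[OF G, symmetric] by simp
      also have "\<dots> = (\<Sum>H\<in>?S. if ?Q H \<cong> G then 1 else 0)"
        unfolding of_nat_sum sum_divide_distrib
        using \<open>card (auto G) > 0\<close> by (intro sum.cong refl) simp
      finally show "real (card (Sur F1 G)) * real (card (Sur F2 G)) / real (card (auto G)) =
          (\<Sum>H\<in>?S. if ?Q H \<cong> G then 1 else 0)" .
    qed
    also have "\<dots> = (\<Sum>H\<in>?S. \<Sum>G\<in>R. if ?Q H \<cong> G then 1 else 0)" by (rule sum.swap)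
    also have "\<dots> = (\<Sum>H\<in>?S. 1)"
    proof (rule sum.cong[OF refl])
      fix H assume "H \<in> ?S"
      then obtain G where G: "G \<in> R" "?Q H \<cong> G" "\<And>G'. G' \<in> R \<Longrightarrow> ?Q H \<cong> G' \<Longrightarrow> G' = G"
        using unique by metis
      then have "(\<Sum>G'\<in>R. if ?Q H \<cong> G' then 1 else 0) = (\<Sum>G'\<in>R. if G' = G then 1 else 0 :: real)"
        by (intro sum.cong refl) metis
      then show "(\<Sum>G'\<in>R. if ?Q H \<cong> G' then 1 else 0 :: real) = 1" using G(1) finR by simp
    qed
    finally show "real (card ?S) =
        (\<Sum>G\<in>R. real (card (Sur F1 G)) * real (card (Sur F2 G)) / real (card (auto G)))" by simp
  qed
qed

section \<open>The duality between the two sums\<close>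

lemma has_sum_finite_sum:
  fixes f :: "'i \<Rightarrow> 'a \<Rightarrow> real"
  assumes "finite I" "\<And>i. i \<in> I \<Longrightarrow> (f i has_sum s i) A"
  shows "((\<lambda>x. \<Sum>i\<in>I. f i x) has_sum (\<Sum>i\<in>I. s i)) A"
  using assms by (induction I rule: finite_induct) (auto intro: has_sum_add)

theorem theorem3p21:
  fixes p :: nat
    and F1 :: "('a, 'c) monoid_scheme"
    and F2 :: "('b, 'd) monoid_scheme"
  assumes "Factorial_Ring.prime p"
    and "finite_abelian_p_group p F1"
    and "finite_abelian_p_group p F2"
  shows "(\<lambda>G. real (card (Sur G F1)) * real (card (Sur G F2)) / real (card (auto G)))
           summable_on iso_reps p
       \<and> (\<lambda>G'. real (card (Sur F1 G')) * real (card (Sur F2 G')) / real (card (auto G')))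
           summable_on iso_reps p
       \<and> c0 p * (\<Sum>\<^sub>\<infinity>G\<in>iso_reps p.
             real (card (Sur G F1)) * real (card (Sur G F2)) / real (card (auto G)))
         = (\<Sum>\<^sub>\<infinity>G'\<in>iso_reps p.
             real (card (Sur F1 G')) * real (card (Sur F2 G')) / real (card (auto G')))"
proof -
  let ?S = "subdirect F1 F2"
  let ?l = "\<lambda>G. real (card (Sur G F1)) * real (card (Sur G F2)) / real (card (auto G))"
  let ?r = "\<lambda>G'. real (card (Sur F1 G')) * real (card (Sur F2 G')) / real (card (auto G'))"
  have F: "group F1" "group F2" "finite (carrier F1)" "finite (carrier F2)"
    using assms(2,3) by (auto simp: finite_abelian_p_group_def comm_group.axioms(2))
  have "((\<lambda>G. \<Sum>H\<in>?S. real (card (Sur G (subproduct F1 F2 H))) / real (card (auto G)))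
      has_sum (\<Sum>H\<in>?S. 1 / c0 p)) (iso_reps p)"
    by (rule has_sum_finite_sum[OF finite_subdirect[OF F(3,4)]])
      (rule has_sum_Sur_moment[OF assms(1) p_group_subdirect[OF assms]])
  moreover have "(\<Sum>H\<in>?S. real (card (Sur G (subproduct F1 F2 H))) / real (card (auto G))) = ?l G"
    if "G \<in> iso_reps p" for G
  proof -
    have G: "group G" "finite (carrier G)"
      using that iso_reps_subset[of p]
      by (auto simp: nat_p_groups_def finite_abelian_p_group_def comm_group.axioms(2))
    show ?thesis
      using card_Sur_pairs[OF G(1) F(1,2) G(2) F(3,4)]
      by (simp flip: sum_divide_distrib of_nat_sum of_nat_mult)
  qed
  ultimately have "(?l has_sum (\<Sum>H\<in>?S. 1 / c0 p)) (iso_reps p)"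
    by (simp cong: has_sum_cong)
  then have l: "(?l has_sum (real (card ?S) / c0 p)) (iso_reps p)" by simp
  have r: "(?r has_sum real (card ?S)) (iso_reps p)"
    by (rule has_sum_card_subdirect[OF assms])
  show ?thesis
    using has_sum_imp_summable[OF l] has_sum_imp_summable[OF r] infsumI[OF l] infsumI[OF r]
      c0_limit(2)[OF assms(1)] by simp
qed

end
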